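(* Let $d=2$ and let $r>0$ be fixed. Then for every $\lambda > \lambda_c(2r)$ we have $\mu_c(\lambda,r) < \infty$.
   Context: Let $\Phi^{(1)}$ and $\Phi^{(2)}$ be independent homogeneous Poisson point processes in $\mathbb{R}^d$ (here $d=2$) with intensities $\lambda>0$ and $\mu>0$ respectively; $|\cdot|$ is the Euclidean norm. A graph percolates if it contains an infinite connected component. For $\rho>0$, the continuum percolation model $\tilde G(\lambda,\rho)$ is the graph with vertex set $\Phi^{(1)}$ and an (undirected) edge between distinct $X_i,X_j\in\Phi^{(1)}$ whenever $|X_i-X_j|\le 2\rho$. Its critical intensity is $\lambda_c(\rho):=\sup\{\lambda>0: \mathsf{P}(\tilde G(\lambda,\rho)\text{ percolates})=0\}$. (So $\lambda_c(2r)$ corresponds to connecting points at distance at most $4r$.) The continuum $AB$ percolation model $G(\lambda,\mu,r)$ is the graph with vertex set $\Phi^{(1)}$ and an edge between distinct $X_i,X_j\in\Phi^{(1)}$ whenever there is some $Y\in\Phi^{(2)}$ with $|X_i-Y|\le 2r$ and $|X_j-Y|\le 2r$. Let $\theta(\lambda,\mu,r)=\mathsf{P}(G(\lambda,\mu,r)\text{ percolates})$ and, for fixed $\lambda,r>0$, define $\mu_c(\lambda,r):=\sup\{\mu>0:\theta(\lambda,\mu,r)=0\}$. *)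

theory Defs
  imports "HOL-Probability.Probability"
begin

text \<open>Locally finite point configurations, with the sigma-algebra generated by the counting maps.\<close>

definition locally_finite_configs :: "'a::euclidean_space set set" where
  "locally_finite_configs = {X. \<forall>B. bounded B \<longrightarrow> finite (X \<inter> B)}"

definition config_space :: "'a::euclidean_space set measure" where
  "config_space = sigma locally_finite_configs
     {{X \<in> locally_finite_configs. card (X \<inter> B) = n} | B n. B \<in> sets borel \<and> bounded B}"

text \<open>A homogeneous Poisson point process has almost surely no multiple points, so it is treated
  as a random set. The Poisson probabilities are written out because the library's \<open>poisson_pmf\<close>
  requires a positive rate, whereas a Borel set may be null.\<close>

definition poisson_point_process ::
    "real \<Rightarrow> 'w measure \<Rightarrow> ('w \<Rightarrow> 'a::euclidean_space set) \<Rightarrow> bool" where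
  "poisson_point_process l M \<Phi> \<longleftrightarrow>
     prob_space M \<and> \<Phi> \<in> measurable M config_space \<and>
     (\<forall>B n. B \<in> sets borel \<and> bounded B \<longrightarrow>
        \<P>(\<omega> in M. card (\<Phi> \<omega> \<inter> B) = n) =
          (l * measure lborel B) ^ n / fact n * exp (- (l * measure lborel B))) \<and>
     (\<forall>\<B>. finite \<B> \<and> disjoint \<B> \<and> (\<forall>B\<in>\<B>. B \<in> sets borel \<and> bounded B) \<longrightarrow>
        prob_space.indep_vars M (\<lambda>_. count_space UNIV) (\<lambda>B \<omega>. card (\<Phi> \<omega> \<inter> B)) \<B>)"

text \<open>The law of a Poisson point process of intensity \<open>l > 0\<close>: the measure on configurations under
  which the identity map is such a process. It is unique because the joint laws of the counts
  determine a measure on the configuration space.\<close>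

definition poisson_law :: "real \<Rightarrow> 'a::euclidean_space set measure" where
  "poisson_law l =
     (THE N. sets N = sets config_space \<and> poisson_point_process l N (\<lambda>X. X))"

text \<open>A graph is given by its vertex set \<open>V\<close> and a symmetric set \<open>E \<subseteq> V \<times> V\<close> of ordered pairs; its
  connected components are the classes of the relation ``joined by a path''.\<close>

definition graph_components :: "'a set \<Rightarrow> ('a \<times> 'a) set \<Rightarrow> 'a set set" where
  "graph_components V E = V // {(x, y). x \<in> V \<and> y \<in> V \<and> (x, y) \<in> E\<^sup>*}"

definition percolates :: "'a set \<Rightarrow> ('a \<times> 'a) set \<Rightarrow> bool" where
  "percolates V E \<longleftrightarrow> (\<exists>C\<in>graph_components V E. infinite C)"

definition continuum_edges :: "real \<Rightarrow> 'a::metric_space set \<Rightarrow> ('a \<times> 'a) set" where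
  "continuum_edges \<rho> X = {(x, x'). x \<in> X \<and> x' \<in> X \<and> x \<noteq> x' \<and> dist x x' \<le> 2 * \<rho>}"

definition AB_edges :: "real \<Rightarrow> 'a::metric_space set \<Rightarrow> 'a set \<Rightarrow> ('a \<times> 'a) set" where
  "AB_edges r X Y = {(x, x'). x \<in> X \<and> x' \<in> X \<and> x \<noteq> x' \<and>
     (\<exists>y\<in>Y. dist x y \<le> 2 * r \<and> dist x' y \<le> 2 * r)}"

text \<open>Percolation probabilities and critical intensities in the plane. Suprema are taken in
  \<^typ>\<open>ennreal\<close>, so that they may be infinite and the supremum of the empty set is \<open>0\<close>.
  Independence of the two processes is expressed by the product of their laws.\<close>

definition continuum_theta :: "real \<Rightarrow> real \<Rightarrow> real" where
  "continuum_theta l \<rho> =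
     \<P>(X in (poisson_law l :: (real^2) set measure). percolates X (continuum_edges \<rho> X))"

definition AB_theta :: "real \<Rightarrow> real \<Rightarrow> real \<Rightarrow> real" where
  "AB_theta l m r =
     \<P>((X, Y) in (poisson_law l :: (real^2) set measure) \<Otimes>\<^sub>M (poisson_law m :: (real^2) set measure).
        percolates X (AB_edges r X Y))"

definition lambda_c :: "real \<Rightarrow> ennreal" where
  "lambda_c \<rho> = Sup {ennreal l | l. l > 0 \<and> continuum_theta l \<rho> = 0}"

definition mu_c :: "real \<Rightarrow> real \<Rightarrow> ennreal" where
  "mu_c l r = Sup {ennreal m | m. m > 0 \<and> AB_theta l m r = 0}"

end

theory Submission
  imports Defs
begin

text \<open>Choose \<open>\<nu>\<close> with \<open>\<lambda>\<^sub>c(2r) < \<nu> < \<lambda>\<close>. Cut the plane into small squares of side \<open>e\<close>. If the continuum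
  model of intensity \<open>\<nu>\<close> percolates, then so does site percolation on the set of occupied squares, two
  squares being adjacent when they contain points at distance about \<open>4r\<close> or less; the squares are
  occupied independently with probability \<open>1 - exp (- \<nu> e\<^sup>2)\<close>. In the AB model use a lattice shrunk by
  a factor \<open>s < 1\<close> with \<open>\<lambda> s\<^sup>2 > \<nu>\<close>. Shrinking leaves room for the midpoint construction: to every
  pair consisting of a site and a neighbour belongs a private tiny cell near their midpoint, all
  of whose points are within distance \<open>2r\<close> of all points of both squares. Call a site good if its square
  contains a point of the first process and all its private cells contain a point of the second.
  As the private cells are disjoint, sites are good independently. For large \<open>\<mu>\<close> the
  squares can be reduced so that the probability of being good is exactly \<open>1 - exp (- \<nu> e\<^sup>2)\<close>. Then good sites and
  occupied squares have the same law, and an infinite cluster of good sites yields one in the AB graph.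

  The Poisson law exists and is unique because void probabilities determine the law of a point
  process: the superpositions of cell processes over different partitions have the same law, and a
  partition that contains given disjoint sets exhibits their counts as independent Poisson variables.\<close>

section \<open>Configurations and void probabilities\<close>

lemma pred_countable_Bex:
  assumes "countable I" "\<And>i. i \<in> I \<Longrightarrow> Measurable.pred M (\<lambda>x. P x i)"
  shows "Measurable.pred M (\<lambda>x. \<exists>i\<in>I. P x i)"
  using assms unfolding pred_def by (intro sets.sets_Collect_countable_Ex') auto

lemma pred_countable_Ball:
  assumes "countable I" "\<And>i. i \<in> I \<Longrightarrow> Measurable.pred M (\<lambda>x. P x i)"
  shows "Measurable.pred M (\<lambda>x. \<forall>i\<in>I. P x i)"
  using assms unfolding pred_def by (intro sets.sets_Collect_countable_All') auto

lemma space_config_space [simp]: "space config_space = locally_finite_configs"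
  unfolding config_space_def by (rule space_measure_of) auto

lemma finite_Int_bounded:
  "X \<in> locally_finite_configs \<Longrightarrow> bounded B \<Longrightarrow> finite (X \<inter> B)"
  by (auto simp: locally_finite_configs_def)

lemma card_Int_measurable:
  fixes B :: "'a::euclidean_space set"
  assumes "B \<in> sets borel" "bounded B"
  shows "(\<lambda>X. card (X \<inter> B)) \<in> measurable config_space (count_space UNIV)"
proof (subst measurable_count_space_eq2_countable, intro conjI ballI)
  fix n :: nat
  have "(\<lambda>X. card (X \<inter> B)) -` {n} \<inter> space config_space
      = {X \<in> locally_finite_configs. card (X \<inter> B) = n}" by auto
  also have "\<dots> \<in> sets config_space"
    unfolding config_space_def using assms by (intro in_measure_of) auto
  finally show "(\<lambda>X. card (X \<inter> B)) -` {n} \<inter> space config_space \<in> sets config_space" .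
qed auto

lemma Int_empty_measurable:
  fixes B :: "'a::euclidean_space set"
  assumes "B \<in> sets borel" "bounded B"
  shows "Measurable.pred config_space (\<lambda>X. X \<inter> B = {})"
proof -
  have "Measurable.pred config_space (\<lambda>X. card (X \<inter> B) = 0)"
    using card_Int_measurable[OF assms] by measurable
  moreover have "card (X \<inter> B) = 0 \<longleftrightarrow> X \<inter> B = {}" if "X \<in> space config_space" for X
    using finite_Int_bounded[OF _ assms(2)] that by auto
  ultimately show ?thesis by (rule measurable_cong[THEN iffD1, rotated])
qed

section \<open>Void events generate the sigma-algebra of counts\<close>

definition void_events :: "'a::euclidean_space set set set" where
  "void_events = {{X \<in> locally_finite_configs. X \<inter> B = {}} | B. B \<in> sets borel \<and> bounded B}"

lemma void_eventsE:
  assumes "E \<in> void_events"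
  obtains B where "B \<in> sets borel" "bounded B" "E = {X \<in> locally_finite_configs. X \<inter> B = {}}"
  using assms unfolding void_events_def by blast

text \<open>Separate the points by disjoint basic open sets.\<close>

lemma card_ge_iff_disjoint_basis:
  fixes A :: "'a::metric_space set"
  assumes basis: "topological_basis \<BB>" and A: "finite A"
  shows "n \<le> card A \<longleftrightarrow> (\<exists>\<U>\<in>{\<U>. finite \<U> \<and> \<U> \<subseteq> \<BB> \<and> disjoint \<U> \<and> card \<U> = n}. \<forall>U\<in>\<U>. A \<inter> U \<noteq> {})"
proof
  assume "n \<le> card A"
  then obtain A' where A': "A' \<subseteq> A" "card A' = n" "finite A'"
    by (meson A obtain_subset_with_card_n)
  have "\<forall>a. \<exists>d>0. \<forall>x\<in>A'. x \<noteq> a \<longrightarrow> d \<le> dist a x"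
    using finite_set_avoid[OF A'(3)] by blast
  then obtain d where d: "\<forall>a. d a > 0 \<and> (\<forall>x\<in>A'. x \<noteq> a \<longrightarrow> d a \<le> dist a x)"
    by (auto dest!: choice)
  \<comment> \<open>Half of the separation radius is taken so that the balls around two different
    points of \<open>A'\<close> cannot meet.\<close>
  have "\<forall>a. \<exists>U. U \<in> \<BB> \<and> a \<in> U \<and> U \<subseteq> ball a (d a / 2)"
  proof
    fix a
    have "a \<in> ball a (d a / 2)" using d by simp
    from topological_basisE[OF basis open_ball this]
    show "\<exists>U. U \<in> \<BB> \<and> a \<in> U \<and> U \<subseteq> ball a (d a / 2)" by blast
  qed
  then obtain U where U': "\<forall>a. U a \<in> \<BB> \<and> a \<in> U a \<and> U a \<subseteq> ball a (d a / 2)"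
    by (auto dest!: choice)
  then have U: "\<And>a. U a \<in> \<BB>" "\<And>a. a \<in> U a" "\<And>a. U a \<subseteq> ball a (d a / 2)" by auto
  have disj: "U a \<inter> U b = {}" if "a \<in> A'" "b \<in> A'" "a \<noteq> b" for a b
  proof (rule ccontr)
    assume "U a \<inter> U b \<noteq> {}"
    then obtain y where "y \<in> U a" "y \<in> U b" by auto
    then have "dist a y < d a / 2" "dist b y < d b / 2" using U(3)[of a] U(3)[of b] by auto
    moreover have "d a \<le> dist a b" "d b \<le> dist a b"
      using d[rule_format, of a] d[rule_format, of b] that by (auto simp: dist_commute)
    ultimately show False using dist_triangle2[of a b y] by linarith
  qed
  have "inj_on U A'"
  proof (rule inj_onI, rule ccontr)
    fix a b assume "a \<in> A'" "b \<in> A'" "U a = U b" "a \<noteq> b"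
    then show False using disj[of a b] U(2)[of a] by auto
  qed
  moreover have "disjoint (U ` A')"
    by (rule disjointI) (metis disj imageE)
  ultimately have "finite (U ` A') \<and> U ` A' \<subseteq> \<BB> \<and> disjoint (U ` A') \<and> card (U ` A') = n"
    using A' U(1) by (auto simp: card_image)
  moreover have "\<forall>V\<in>U ` A'. A \<inter> V \<noteq> {}" using A'(1) U(2) by auto
  ultimately show "\<exists>\<U>\<in>{\<U>. finite \<U> \<and> \<U> \<subseteq> \<BB> \<and> disjoint \<U> \<and> card \<U> = n}. \<forall>U\<in>\<U>. A \<inter> U \<noteq> {}"
    by blast
next
  assume "\<exists>\<U>\<in>{\<U>. finite \<U> \<and> \<U> \<subseteq> \<BB> \<and> disjoint \<U> \<and> card \<U> = n}. \<forall>U\<in>\<U>. A \<inter> U \<noteq> {}"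
  then obtain \<U> where \<U>: "disjoint \<U>" "card \<U> = n" "\<And>U. U \<in> \<U> \<Longrightarrow> \<exists>a. a \<in> A \<inter> U" by blast
  from \<U>(3) have "\<forall>U\<in>\<U>. \<exists>a. a \<in> A \<inter> U" by blast
  from bchoice[OF this] obtain g where g: "\<And>U. U \<in> \<U> \<Longrightarrow> g U \<in> A \<inter> U" by blast
  have "inj_on g \<U>"
  proof (rule inj_onI, rule ccontr)
    fix U V assume UV: "U \<in> \<U>" "V \<in> \<U>" "g U = g V" "U \<noteq> V"
    then have "U \<inter> V = {}" using \<U>(1) by (auto simp: disjoint_def)
    with g[OF UV(1)] g[OF UV(2)] UV(3) show False by auto
  qed
  moreover have "g ` \<U> \<subseteq> A" using g by auto
  ultimately show "n \<le> card A" using A \<U>(2) card_inj_on_le by blast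
qed

text \<open>By the criterion above, having at least \<open>n\<close> points in \<open>B\<close> is a
  countable union, over finite disjoint families of basic open sets, of finite intersections of
  events that \<open>B \<inter> U\<close> is hit. Exact counts are differences of such events;
  conversely a void event is the event of count zero. Measurability of random sets and equality of
  their laws can then be tested on void events.\<close>

lemma sets_config_space: "sets (config_space :: 'a::euclidean_space set measure) =
    sigma_sets locally_finite_configs void_events"
proof -
  define V :: "'a set measure" where "V = sigma locally_finite_configs void_events"
  have sub: "void_events \<subseteq> Pow (locally_finite_configs :: 'a set set)" by (auto simp: void_events_def)
  then have space_V [simp]: "space V = locally_finite_configs" and sets_V: "sets V = sigma_sets locally_finite_configs void_events"
    by (auto simp: V_def)
  have pred_void: "Measurable.pred V (\<lambda>X. X \<inter> B = {})" if "B \<in> sets borel" "bounded B" for B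
    using that by (auto simp: pred_def sets_V void_events_def intro!: sigma_sets.Basic)
  obtain \<BB> :: "'a set set" where \<BB>: "countable \<BB>" "topological_basis \<BB>"
    using ex_countable_basis by blast
  have card_V: "Measurable.pred V (\<lambda>X. n \<le> card (X \<inter> B))" if B: "B \<in> sets borel" "bounded B" for B n
  proof -
    let ?I = "{\<U>. finite \<U> \<and> \<U> \<subseteq> \<BB> \<and> disjoint \<U> \<and> card \<U> = n}"
    have "countable {\<U>. finite \<U> \<and> \<U> \<subseteq> \<BB>}"
      using countable_Collect_finite_subset[OF \<BB>(1)] by simp
    then have I: "countable ?I" by (rule countable_subset[rotated]) auto
    have "Measurable.pred V (\<lambda>X. \<exists>\<U>\<in>?I. \<forall>U\<in>\<U>. X \<inter> (B \<inter> U) \<noteq> {})"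
    proof (intro pred_countable_Bex[OF I] pred_countable_Ball)
      fix \<U> assume \<U>: "\<U> \<in> ?I"
      then show "countable \<U>" by (auto intro: countable_finite)
      fix U assume "U \<in> \<U>"
      with \<U> \<BB>(2) have "open U" by (auto intro: topological_basis_open)
      then have "B \<inter> U \<in> sets borel" "bounded (B \<inter> U)" using B by auto
      from pred_void[OF this] show "Measurable.pred V (\<lambda>X. X \<inter> (B \<inter> U) \<noteq> {})" by measurable
    qed
    moreover have "n \<le> card (X \<inter> B) \<longleftrightarrow> (\<exists>\<U>\<in>?I. \<forall>U\<in>\<U>. X \<inter> (B \<inter> U) \<noteq> {})" if "X \<in> space V" for X
      using card_ge_iff_disjoint_basis[OF \<BB>(2) finite_Int_bounded[OF _ B(2)], of X n] that
      by (simp add: Int_assoc)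
    ultimately show ?thesis by (rule measurable_cong[THEN iffD2, rotated])
  qed
  show ?thesis
  proof (rule equalityI)
    have "{X \<in> locally_finite_configs. card (X \<inter> B) = n} \<in> sets V" if "B \<in> sets borel" "bounded B" for B n
    proof -
      have "Measurable.pred V (\<lambda>X. n \<le> card (X \<inter> B) \<and> \<not> Suc n \<le> card (X \<inter> B))"
        using card_V[OF that] by (intro pred_intros_logic)
      then have "{X \<in> space V. n \<le> card (X \<inter> B) \<and> \<not> Suc n \<le> card (X \<inter> B)} \<in> sets V"
        by (simp only: pred_def)
      also have "{X \<in> space V. n \<le> card (X \<inter> B) \<and> \<not> Suc n \<le> card (X \<inter> B)}
         = {X \<in> locally_finite_configs. card (X \<inter> B) = n}" by auto
      finally show ?thesis .
    qed
    then have "{{X \<in> locally_finite_configs. card (X \<inter> B) = n} | B n. B \<in> sets borel \<and> bounded B} \<subseteq> sets V"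
      by blast
    from sets.sigma_sets_subset[OF this]
    show "sets (config_space :: 'a set measure) \<subseteq> sigma_sets locally_finite_configs void_events"
      unfolding sets_V[symmetric] config_space_def space_V by (subst sets_measure_of) auto
    have "void_events \<subseteq> sets (config_space :: 'a set measure)"
      using Int_empty_measurable by (auto simp: void_events_def pred_def)
    from sets.sigma_sets_subset[OF this] show "sigma_sets locally_finite_configs void_events \<subseteq> sets (config_space :: 'a set measure)"
      by simp
  qed
qed

lemma measurable_config_spaceI:
  fixes \<Phi> :: "'w \<Rightarrow> 'a::euclidean_space set"
  assumes "\<And>\<omega>. \<omega> \<in> space M \<Longrightarrow> \<Phi> \<omega> \<in> locally_finite_configs"
    and "\<And>B. B \<in> sets borel \<Longrightarrow> bounded B \<Longrightarrow> Measurable.pred M (\<lambda>\<omega>. \<Phi> \<omega> \<inter> B = {})"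
  shows "\<Phi> \<in> measurable M config_space"
proof (rule measurable_sigma_sets[OF sets_config_space])
  show "void_events \<subseteq> Pow (locally_finite_configs :: 'a set set)" by (auto simp: void_events_def)
  show "\<Phi> \<in> space M \<rightarrow> locally_finite_configs" using assms(1) by auto
  fix y :: "'a set set" assume "y \<in> void_events"
  then obtain B where B: "B \<in> sets borel" "bounded B" "y = {X \<in> locally_finite_configs. X \<inter> B = {}}"
    by (auto simp: void_events_def)
  have "\<Phi> -` y \<inter> space M = {\<omega>\<in>space M. \<Phi> \<omega> \<inter> B = {}}" using assms(1) B by auto
  then show "\<Phi> -` y \<inter> space M \<in> sets M" using assms(2)[OF B(1,2)] by (simp add: pred_def)
qed

text \<open>Renyi's theorem: the void events are stable under intersection.\<close>

lemma config_measure_eqI: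
  fixes N N' :: "'a::euclidean_space set measure"
  assumes "prob_space N" "prob_space N'" "sets N = sets config_space" "sets N' = sets config_space"
    and eq: "\<And>B. B \<in> sets borel \<Longrightarrow> bounded B \<Longrightarrow>
      \<P>(X in N. X \<inter> B = {}) = \<P>(X in N'. X \<inter> B = {})"
  shows "N = N'"
proof -
  interpret N: prob_space N by fact
  interpret N': prob_space N' by fact
  have sp: "space N = locally_finite_configs" "space N' = locally_finite_configs"
    using assms(3,4)[THEN sets_eq_imp_space_eq] by auto
  \<comment> \<open>The void event of the empty set is the whole space, so a constant sequence
    serves as the exhausting sequence.\<close>
  show ?thesis
  proof (rule measure_eqI_generator_eq[where E = void_events and \<Omega> = locally_finite_configs
        and A = "\<lambda>_. {X \<in> locally_finite_configs. X \<inter> {} = {}}"])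
    show "Int_stable (void_events :: 'a set set set)"
    proof (rule Int_stableI)
      fix a b :: "'a set set" assume "a \<in> void_events" "b \<in> void_events"
      then obtain B C where "a = {X \<in> locally_finite_configs. X \<inter> B = {}}" "b = {X \<in> locally_finite_configs. X \<inter> C = {}}"
        and BC: "B \<in> sets borel" "bounded B" "C \<in> sets borel" "bounded C"
        unfolding void_events_def by blast
      then have "a \<inter> b = {X \<in> locally_finite_configs. X \<inter> (B \<union> C) = {}}" by auto
      then show "a \<inter> b \<in> void_events"
        unfolding void_events_def using BC by (intro CollectI exI[of _ "B \<union> C"]) auto
    qed
    show "emeasure N E = emeasure N' E" if "E \<in> void_events" for E
      using that
    proof (rule void_eventsE)
      fix B assume B: "B \<in> sets borel" "bounded B" "E = {X \<in> locally_finite_configs. X \<inter> B = {}}"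
      then show "emeasure N E = emeasure N' E"
        using eq[OF B(1,2)] by (simp add: N.emeasure_eq_measure N'.emeasure_eq_measure sp)
    qed
    show "range (\<lambda>_. {X \<in> locally_finite_configs. X \<inter> {} = {}}) \<subseteq> (void_events :: 'a set set set)"
      unfolding void_events_def by (intro image_subsetI CollectI exI[of _ "{}"]) simp
    show "void_events \<subseteq> Pow (locally_finite_configs :: 'a set set)" by (auto simp: void_events_def)
    show "emeasure N {X \<in> locally_finite_configs. X \<inter> {} = {}} \<noteq> \<infinity>" for i :: nat by simp
    show "sets N = sigma_sets locally_finite_configs void_events"
      "sets N' = sigma_sets locally_finite_configs void_events"
      unfolding assms(3,4) sets_config_space by (rule refl)+
  qed simp
qed

section \<open>The Poisson process in one cell\<close>

text \<open>The joint law of two coordinates is \<open>U \<Otimes>\<^sub>M U\<close>, and by Fubini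
  the diagonal is null because \<open>U\<close> has no atoms. Later this ensures that a set of
  sample points has as many elements as there are samples.\<close>

lemma AE_PiM_distinct:
  fixes U :: "'a::{second_countable_topology, t2_space} measure"
  assumes U: "prob_space U" "sets U = sets borel" and null: "\<And>x. emeasure U {x} = 0" and ij: "(i::nat) \<noteq> j"
  shows "AE x in (\<Pi>\<^sub>M i\<in>(UNIV::nat set). U). x i \<noteq> x j"
proof -
  let ?S = "\<Pi>\<^sub>M i\<in>(UNIV::nat set). U"
  interpret U: prob_space U by fact
  interpret product_prob_space "\<lambda>_::nat. U" UNIV by unfold_locales
  have D: "U \<Otimes>\<^sub>M U = distr ?S (U \<Otimes>\<^sub>M U) (\<lambda>x. (x i, x j))"
  proof (rule pair_measure_eqI)
    fix A B assume AB: "A \<in> sets U" "B \<in> sets U"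
    have "emeasure (distr ?S (U \<Otimes>\<^sub>M U) (\<lambda>x. (x i, x j))) (A \<times> B)
        = emeasure ?S {x \<in> space ?S. \<forall>k\<in>{i, j}. x k \<in> (if k = i then A else B)}"
      using AB ij by (subst emeasure_distr) (auto intro!: arg_cong[where f = "emeasure _"])
    also have "\<dots> = (\<Prod>k\<in>{i, j}. emeasure U (if k = i then A else B))"
      using AB by (intro emeasure_PiM_Collect) auto
    also have "\<dots> = emeasure U A * emeasure U B" using ij by simp
    finally show "emeasure U A * emeasure U B = emeasure (distr ?S (U \<Otimes>\<^sub>M U) (\<lambda>x. (x i, x j))) (A \<times> B)"
      by simp
  qed (simp_all add: U.sigma_finite_measure_axioms)
  interpret UU: pair_sigma_finite U U by unfold_locales
  note [measurable_cong] = U(2)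
  have m: "Measurable.pred (U \<Otimes>\<^sub>M U) (\<lambda>z. fst z \<noteq> snd z)" by measurable
  have "AE y in U. x \<noteq> y" for x
    using null[of x] U(2) by (intro AE_I[of _ _ "{x}"]) auto
  then have "AE z in U \<Otimes>\<^sub>M U. fst z \<noteq> snd z"
    using m by (intro UU.AE_pair_measure) (auto simp: pred_def)
  then have "AE z in distr ?S (U \<Otimes>\<^sub>M U) (\<lambda>x. (x i, x j)). fst z \<noteq> snd z"
    by (simp only: D[symmetric])
  then show ?thesis
    using m by (subst (asm) AE_distr_iff) (auto simp: pred_def)
qed

text \<open>The generating function of the Poisson distribution with parameter \<open>a\<close>.
  With \<open>q\<close> the probability that one point misses a set, it averages
  \<open>q ^ n\<close> over the random number \<open>n\<close> of points and yields a void
  probability.\<close>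

lemma poisson_sums: "(\<lambda>n. a ^ n / fact n * exp (- a) * q ^ n) sums exp (- (a * (1 - q)))" for a q :: real
proof -
  have "(\<lambda>n. exp (- a) * ((a * q) ^ n /\<^sub>R fact n)) sums (exp (- a) * exp (a * q))"
    by (intro sums_mult exp_converges)
  moreover have "exp (- a) * ((a * q) ^ n /\<^sub>R fact n) = a ^ n / fact n * exp (- a) * q ^ n" for n
    by (simp add: field_simps power_mult_distrib)
  moreover have "exp (- a) * exp (a * q) = exp (- (a * (1 - q)))"
    by (simp add: mult_exp_exp algebra_simps)
  ultimately show ?thesis by simp
qed

text \<open>Nothing is said about \<open>N\<close> outside \<open>P\<close>; points there are cut
  off when the cells are put together. The count is prescribed for the whole cell only, since any
  other bounded Borel set can be made a cell of another partition.\<close>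

definition cell_law :: "real \<Rightarrow> 'a::euclidean_space set \<Rightarrow> 'a set measure \<Rightarrow> bool" where
  "cell_law l P N \<longleftrightarrow> prob_space N \<and> sets N = sets config_space \<and>
     (\<forall>B\<in>sets borel. \<P>(X in N. X \<inter> (P \<inter> B) = {}) = exp (- (l * measure lborel (P \<inter> B)))) \<and>
     (\<forall>n. \<P>(X in N. card (X \<inter> P) = n) = (l * measure lborel P) ^ n / fact n * exp (- (l * measure lborel P)))"

text \<open>On a null cell there is no uniform distribution to sample from, but the empty
  configuration has the right void probabilities and count law.\<close>

lemma ex_cell_law_null:
  fixes P :: "'a::euclidean_space set"
  assumes P: "P \<in> sets borel" "bounded P" "measure lborel P = 0"
  shows "\<exists>N. cell_law l P N"
proof (intro exI)
  have e: "{} \<in> (locally_finite_configs :: 'a set set)" by (simp add: locally_finite_configs_def)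
  have "measure lborel (P \<inter> B) = 0" if "B \<in> sets borel" for B
  proof -
    have "measure lborel (P \<inter> B) \<le> measure lborel P"
      using P emeasure_bounded_finite[of P] that by (intro measure_mono_fmeasurable) (auto simp: fmeasurable_def)
    then show ?thesis using P(3) measure_nonneg[of lborel "P \<inter> B"] by linarith
  qed
  moreover have "{X \<in> locally_finite_configs. X \<inter> (P \<inter> B) = {}} \<in> sets config_space" if "B \<in> sets borel" for B
    using Int_empty_measurable[of "P \<inter> B"] P that by (auto simp: pred_def bounded_Int)
  moreover have "{X \<in> locally_finite_configs. card (X \<inter> P) = n} \<in> sets config_space" for n
    using measurable_sets[OF card_Int_measurable[OF P(1,2)], of "{n}"] by (simp add: vimage_def Int_def conj_commute)
  ultimately show "cell_law l P (return config_space {})"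
    unfolding cell_law_def using P e
    by (auto simp: prob_space_return measure_return indicator_def power_0_left)
qed

text \<open>Take a Poisson number of independent points, uniform on \<open>P\<close>. Given
  \<open>n\<close> points, each misses \<open>P \<inter> B\<close> with the same probability
  \<open>q\<close>, so the void probability is the Poisson average of \<open>q ^ n\<close>. Almost
  surely the points are distinct and lie in \<open>P\<close>, so the count is the Poisson number
  itself.\<close>

lemma ex_cell_law:
  fixes P :: "'a::euclidean_space set"
  assumes P: "P \<in> sets borel" "bounded P" and l: "l > 0"
  shows "\<exists>N. cell_law l P N"
proof (cases "measure lborel P = 0")
  case True
  with P show ?thesis by (rule ex_cell_law_null)
next
  case False
  define p where "p = measure lborel P"
  have p: "p > 0" using False by (simp add: p_def zero_less_measure_iff)
  define U where "U = uniform_measure lborel P"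
  have eP: "emeasure lborel P = ennreal p"
    using emeasure_bounded_finite[OF P(2)] by (simp add: p_def emeasure_eq_ennreal_measure)
  have U: "prob_space U" unfolding U_def using p eP by (intro prob_space_uniform_measure) auto
  interpret U: prob_space U by fact
  have sets_U [simp, measurable_cong]: "sets U = sets borel" by (simp add: U_def)
  have space_U [simp]: "space U = UNIV" by (simp add: U_def)
  let ?S = "\<Pi>\<^sub>M i\<in>(UNIV::nat set). U"
  interpret S: product_prob_space "\<lambda>_::nat. U" UNIV by unfold_locales
  define a where "a = l * p"
  have a: "a > 0" using l p by (simp add: a_def)
  define K where "K = measure_pmf (poisson_pmf a)"
  have sets_K [simp, measurable_cong]: "sets K = sets (count_space UNIV)" by (simp add: K_def)
  have space_K [simp]: "space K = UNIV" by (simp add: K_def)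
  have K: "prob_space K" unfolding K_def by (rule measure_pmf.prob_space_axioms)
  interpret K: prob_space K by fact
  define M where "M = K \<Otimes>\<^sub>M ?S"
  interpret KS: pair_prob_space K ?S by unfold_locales
  interpret M: prob_space M unfolding M_def by unfold_locales
  have space_M [simp]: "space M = UNIV" by (simp add: M_def space_pair_measure space_PiM)
  note [measurable_cong] = M_def[THEN arg_cong[where f=sets]]
  \<comment> \<open>The points are the first \<open>n\<close> terms of an infinite sample, so that
    one product space serves for every value of \<open>n\<close>.\<close>
  define \<Phi> :: "nat \<times> (nat \<Rightarrow> 'a) \<Rightarrow> 'a set" where "\<Phi> = (\<lambda>(n, x). x ` {..<n})"
  have void_iff: "\<Phi> \<omega> \<inter> B = {} \<longleftrightarrow> (\<forall>i. i < fst \<omega> \<longrightarrow> snd \<omega> i \<notin> B)" for \<omega> B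
    by (auto simp: \<Phi>_def split: prod.splits)
  have void_meas: "Measurable.pred M (\<lambda>\<omega>. \<Phi> \<omega> \<inter> B = {})" if [measurable]: "B \<in> sets borel" for B
    unfolding void_iff M_def by measurable
  have \<Phi>: "\<Phi> \<in> measurable M config_space"
    using void_meas by (intro measurable_config_spaceI) (auto simp: locally_finite_configs_def \<Phi>_def)
  have void: "measure M {\<omega>. \<Phi> \<omega> \<inter> (P \<inter> B) = {}} = exp (- (l * measure lborel (P \<inter> B)))" if B: "B \<in> sets borel" for B
  proof -
    define q where "q = measure U (UNIV - P \<inter> B)"
    have PB: "P \<inter> B \<in> sets borel" using P B by auto
    have "measure U (P \<inter> B) = measure lborel (P \<inter> B) / p"
      unfolding U_def using eP p PB P by (subst measure_uniform_measure) (auto simp: p_def Int_absorb1)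
    then have q: "1 - q = measure lborel (P \<inter> B) / p"
      unfolding q_def using PB U.prob_compl[of "P \<inter> B"] by simp
    have q0: "q \<ge> 0" by (simp add: q_def)
    let ?E = "{\<omega>. \<Phi> \<omega> \<inter> (P \<inter> B) = {}}"
    have E: "?E \<in> sets (K \<Otimes>\<^sub>M ?S)" unfolding M_def[symmetric] using void_meas[OF PB] by (simp add: pred_def)
    have "emeasure ?S (Pair n -` ?E) = ennreal (q ^ n)" for n
    proof -
      have "Pair n -` ?E = {x \<in> space ?S. \<forall>i\<in>{..<n}. x i \<in> UNIV - P \<inter> B}"
        by (auto simp: void_iff space_PiM)
      also have "emeasure ?S \<dots> = (\<Prod>i\<in>{..<n}. emeasure U (UNIV - P \<inter> B))"
        using PB by (intro S.emeasure_PiM_Collect) auto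
      also have "\<dots> = ennreal (q ^ n)"
        by (simp add: q_def U.emeasure_eq_measure ennreal_power)
      finally show ?thesis .
    qed
    then have "emeasure M ?E = (\<integral>\<^sup>+n. ennreal (q ^ n) \<partial>K)"
      unfolding M_def by (subst S.P.emeasure_pair_measure_alt[OF E]) simp
    also have "\<dots> = (\<integral>\<^sup>+n. ennreal (a ^ n / fact n * exp (- a) * q ^ n) \<partial>count_space UNIV)"
      unfolding K_def nn_integral_measure_pmf using a q0
      by (intro nn_integral_cong) (simp add: ennreal_mult[symmetric])
    also have "\<dots> = ennreal (exp (- (a * (1 - q))))"
      unfolding nn_integral_count_space_nat using a q0 by (intro suminf_ennreal_eq poisson_sums) auto
    finally have "measure M ?E = exp (- (a * (1 - q)))" by (simp add: measure_def)
    then show ?thesis using p by (simp add: q a_def)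
  qed
  have card: "measure M {\<omega>. card (\<Phi> \<omega> \<inter> P) = n} = a ^ n / fact n * exp (- a)" for n
  proof -
    have "AE x in ?S. \<forall>i j. i \<noteq> j \<longrightarrow> x i \<noteq> x j"
    proof (intro AE_all_countable[THEN iffD2] allI)
      fix i j :: nat
      have "emeasure U {x} = 0" for x
        unfolding U_def using P
        by (subst emeasure_uniform_measure) (auto intro!: emeasure_lborel_countable countable_finite simp: eP p)
      then show "AE x in ?S. i \<noteq> j \<longrightarrow> x i \<noteq> x j"
        using AE_PiM_distinct[OF U, of i j] by (cases "i = j") auto
    qed
    moreover have "AE x in ?S. \<forall>i. x i \<in> P"
    proof (intro AE_all_countable[THEN iffD2] allI)
      fix i :: nat
      have "AE x in U. x \<in> P" unfolding U_def using P by (intro AE_uniform_measureI) auto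
      then have "AE x in distr ?S U (\<lambda>x. x i). x \<in> P" by (subst S.PiM_component) auto
      then show "AE x in ?S. x i \<in> P" using P by (subst (asm) AE_distr_iff) auto
    qed
    ultimately have AE_S: "AE x in ?S. (\<forall>i j. i \<noteq> j \<longrightarrow> x i \<noteq> x j) \<and> (\<forall>i. x i \<in> P)" by auto
    have pred_KS: "Measurable.pred (K \<Otimes>\<^sub>M ?S) (\<lambda>\<omega>. (\<forall>i j. i \<noteq> j \<longrightarrow> snd \<omega> i \<noteq> snd \<omega> j) \<and> (\<forall>i. snd \<omega> i \<in> P))"
    proof (intro pred_intros_logic pred_intros_countable)
      fix i j :: nat
      have [measurable]: "(\<lambda>\<omega>. snd \<omega> k) \<in> borel_measurable (K \<Otimes>\<^sub>M ?S)" for k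
      proof -
        have "(\<lambda>x. x k) \<in> measurable ?S borel"
          using measurable_component_singleton[of k UNIV "\<lambda>_. U"] by simp
        then show ?thesis by (rule measurable_compose[OF measurable_snd])
      qed
      show "Measurable.pred (K \<Otimes>\<^sub>M ?S) (\<lambda>\<omega>. snd \<omega> i = snd \<omega> j)" by measurable
      show "Measurable.pred (K \<Otimes>\<^sub>M ?S) (\<lambda>\<omega>. snd \<omega> i \<in> P)" using P(1) by measurable
    qed simp
    have "AE \<omega> in M. (\<forall>i j. i \<noteq> j \<longrightarrow> snd \<omega> i \<noteq> snd \<omega> j) \<and> (\<forall>i. snd \<omega> i \<in> P)"
      unfolding M_def
    proof (rule KS.AE_pair_measure)
      show "AE n in K. AE x in ?S. (\<forall>i j. i \<noteq> j \<longrightarrow> snd (n, x) i \<noteq> snd (n, x) j) \<and> (\<forall>i. snd (n, x) i \<in> P)"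
        unfolding snd_conv by (rule AE_I2) (rule AE_S)
    qed (use pred_KS in \<open>simp only: pred_def\<close>)
    then have "AE \<omega> in M. card (\<Phi> \<omega> \<inter> P) = n \<longleftrightarrow> fst \<omega> = n"
    proof (rule AE_mp, intro AE_I2 impI)
      fix \<omega> :: "nat \<times> (nat \<Rightarrow> 'a)"
      assume *: "(\<forall>i j. i \<noteq> j \<longrightarrow> snd \<omega> i \<noteq> snd \<omega> j) \<and> (\<forall>i. snd \<omega> i \<in> P)"
      then have "\<Phi> \<omega> \<inter> P = snd \<omega> ` {..<fst \<omega>}" by (auto simp: \<Phi>_def split: prod.splits)
      moreover have "inj_on (snd \<omega>) {..<fst \<omega>}" using * by (auto simp: inj_on_def)
      ultimately show "card (\<Phi> \<omega> \<inter> P) = n \<longleftrightarrow> fst \<omega> = n" by (simp add: card_image)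
    qed
    moreover have "{\<omega>. card (\<Phi> \<omega> \<inter> P) = n} \<in> sets M"
      using measurable_sets[OF measurable_compose[OF \<Phi> card_Int_measurable[OF P]], of "{n}"]
      by (simp add: vimage_def)
    moreover have "{\<omega>. fst \<omega> = n} = {n} \<times> space ?S" by (auto simp: space_PiM)
    ultimately have "measure M {\<omega>. card (\<Phi> \<omega> \<inter> P) = n} = measure M ({n} \<times> space ?S)"
      by (intro M.finite_measure_eq_AE) (auto simp: M_def)
    also have "\<dots> = measure K {n}"
      unfolding M_def measure_def
      by (subst S.P.emeasure_pair_measure_Times) (auto simp: S.P.emeasure_space_1)
    finally show ?thesis using a by (simp add: K_def measure_pmf_single)
  qed
  have "cell_law l P (distr M config_space \<Phi>)"
    unfolding cell_law_def
  proof (intro conjI ballI allI)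
    show "prob_space (distr M config_space \<Phi>)" using \<Phi> by (rule M.prob_space_distr)
    fix B :: "'a set" assume "B \<in> sets borel"
    then have "Measurable.pred config_space (\<lambda>X. X \<inter> (P \<inter> B) = {})"
      using P by (intro Int_empty_measurable) (auto simp: bounded_Int)
    then show "\<P>(X in distr M config_space \<Phi>. X \<inter> (P \<inter> B) = {}) = exp (- (l * measure lborel (P \<inter> B)))"
      using void[OF \<open>B \<in> sets borel\<close>] measurable_space[OF \<Phi>]
      by (subst measure_distr[OF \<Phi>]) (auto simp: pred_def vimage_def)
  next
    fix n
    have "Measurable.pred config_space (\<lambda>X. card (X \<inter> P) = n)"
      using card_Int_measurable[OF P] by measurable
    then show "\<P>(X in distr M config_space \<Phi>. card (X \<inter> P) = n) =
        (l * measure lborel P) ^ n / fact n * exp (- (l * measure lborel P))"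
      using card[of n] measurable_space[OF \<Phi>]
      by (subst measure_distr[OF \<Phi>]) (auto simp: pred_def vimage_def a_def p_def)
  qed simp
  then show ?thesis by blast
qed

section \<open>Existence and uniqueness of the Poisson law\<close>

text \<open>The last clause makes a union of configurations taken from the single cells locally
  finite, and it reduces events about a bounded set to finitely many cells.\<close>

definition bounded_partition :: "(nat \<Rightarrow> 'a::euclidean_space set) \<Rightarrow> bool" where
  "bounded_partition P \<longleftrightarrow> disjoint_family P \<and> (\<Union>i. P i) = UNIV \<and>
     (\<forall>i. P i \<in> sets borel \<and> bounded (P i)) \<and> (\<forall>B. bounded B \<longrightarrow> finite {i. P i \<inter> B \<noteq> {}})"

lemma sets_Collect_void:
  fixes B :: "'a::euclidean_space set"
  assumes "sets N = sets config_space" "B \<in> sets borel" "bounded B"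
  shows "{X \<in> space N. X \<inter> B = {}} \<in> sets N"
  using Int_empty_measurable[OF assms(2,3)] sets_eq_imp_space_eq[OF assms(1)] assms(1) by (simp add: pred_def)

lemma sets_Collect_card:
  fixes B :: "'a::euclidean_space set"
  assumes "sets N = sets config_space" "B \<in> sets borel" "bounded B"
  shows "{X \<in> space N. card (X \<inter> B) \<in> C} \<in> sets N"
  using measurable_sets[OF card_Int_measurable[OF assms(2,3)], of C] sets_eq_imp_space_eq[OF assms(1)] assms(1)
  by (simp add: vimage_def Int_def conj_commute)

text \<open>Independent cell processes are cut down to their own cells and united. Void
  probabilities multiply over the finitely many cells met by \<open>B\<close>, and the exponents add
  up to the volume of \<open>B\<close>; counts in different cells depend on different coordinates.
  The void formula does not depend on \<open>P\<close>, which makes different partitions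
  comparable.\<close>

lemma superposition:
  fixes P :: "nat \<Rightarrow> 'a::euclidean_space set"
  assumes P: "bounded_partition P" and l: "l > 0"
  obtains N where "prob_space N" "sets N = sets config_space"
    "\<And>B. B \<in> sets borel \<Longrightarrow> bounded B \<Longrightarrow> \<P>(X in N. X \<inter> B = {}) = exp (- (l * measure lborel B))"
    "\<And>i n. \<P>(X in N. card (X \<inter> P i) = n) = (l * measure lborel (P i)) ^ n / fact n * exp (- (l * measure lborel (P i)))"
    "\<And>J C. finite J \<Longrightarrow> \<P>(X in N. \<forall>j\<in>J. card (X \<inter> P j) \<in> C j) = (\<Prod>j\<in>J. \<P>(X in N. card (X \<inter> P j) \<in> C j))"
proof -
  have disj: "disjoint_family P" and cover: "(\<Union>i. P i) = UNIV"
    and Pb: "P i \<in> sets borel" "bounded (P i)" and fin: "bounded B \<Longrightarrow> finite {i. P i \<inter> B \<noteq> {}}" for i B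
    using P by (auto simp: bounded_partition_def)
  have "\<forall>i. \<exists>N. cell_law l (P i) N" using ex_cell_law[OF Pb l] by blast
  from choice[OF this] obtain NN where NN: "\<And>i. cell_law l (P i) (NN i)" by blast
  have sets_NN [measurable_cong]: "sets (NN i) = sets config_space" for i using NN by (auto simp: cell_law_def)
  have space_NN: "space (NN i) = locally_finite_configs" for i using sets_eq_imp_space_eq[OF sets_NN[of i]] by simp
  have "prob_space (NN i)" for i using NN by (auto simp: cell_law_def)
  then interpret product_prob_space NN UNIV
    by (intro product_prob_space.intro product_prob_space_axioms.intro product_sigma_finite.intro)
      (auto intro: prob_space_imp_sigma_finite)
  define M where "M = PiM UNIV NN"
  interpret W: prob_space M unfolding M_def by unfold_locales
  have space_M: "\<omega> \<in> space M \<longleftrightarrow> (\<forall>i. \<omega> i \<in> locally_finite_configs)" for \<omega>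
    by (auto simp: M_def space_PiM space_NN PiE_iff)
  define \<Phi> :: "(nat \<Rightarrow> 'a set) \<Rightarrow> 'a set" where "\<Phi> \<omega> = (\<Union>i. \<omega> i \<inter> P i)" for \<omega>
  have P_unique: "i = j" if "x \<in> P i" "x \<in> P j" for x i j
    using disjoint_family_onD[OF disj, of i j] that by auto
  have \<Phi>_P: "\<Phi> \<omega> \<inter> P i = \<omega> i \<inter> P i" for \<omega> i
    using P_unique by (auto simp: \<Phi>_def)
  have void_iff: "\<Phi> \<omega> \<inter> B = {} \<longleftrightarrow> (\<forall>i\<in>{i. P i \<inter> B \<noteq> {}}. \<omega> i \<inter> (P i \<inter> B) = {})" for \<omega> B
    by (auto simp: \<Phi>_def)
  have prod_M: "measure M {\<omega> \<in> space M. \<forall>i\<in>J. \<omega> i \<in> A i} = (\<Prod>i\<in>J. measure (NN i) (A i))"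
    if "finite J" "\<And>i. i \<in> J \<Longrightarrow> A i \<in> sets (NN i)" for J A
    using emeasure_PiM_Collect[of J A] that
    unfolding M_def[symmetric] by (simp add: W.emeasure_eq_measure M.emeasure_eq_measure prod_ennreal prod_nonneg)
  have \<Phi>: "\<Phi> \<in> measurable M config_space"
  proof (rule measurable_config_spaceI)
    fix \<omega> assume \<omega>: "\<omega> \<in> space M"
    show "\<Phi> \<omega> \<in> locally_finite_configs"
      unfolding locally_finite_configs_def
    proof (intro CollectI allI impI)
      fix B :: "'a set" assume B: "bounded B"
      have "\<Phi> \<omega> \<inter> B \<subseteq> (\<Union>i\<in>{i. P i \<inter> B \<noteq> {}}. \<omega> i \<inter> P i)" by (auto simp: \<Phi>_def)
      moreover have "finite \<dots>"
        using fin[OF B] finite_Int_bounded[OF _ Pb(2)] \<omega> by (auto simp: space_M)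
      ultimately show "finite (\<Phi> \<omega> \<inter> B)" by (rule finite_subset)
    qed
  next
    fix B :: "'a set" assume B: "B \<in> sets borel" "bounded B"
    have "Measurable.pred M (\<lambda>\<omega>. \<omega> i \<inter> (P i \<inter> B) = {})" for i
    proof -
      have "(\<lambda>\<omega>. \<omega> i) \<in> measurable M config_space" unfolding M_def by measurable
      moreover have "Measurable.pred config_space (\<lambda>X. X \<inter> (P i \<inter> B) = {})"
        using B Pb(1) by (intro Int_empty_measurable) (auto simp: bounded_Int)
      ultimately show ?thesis by (rule measurable_compose)
    qed
    then show "Measurable.pred M (\<lambda>\<omega>. \<Phi> \<omega> \<inter> B = {})"
      unfolding void_iff by (intro pred_intros_finite(3) fin B(2))
  qed
  show ?thesis
  proof (rule that)
    let ?N = "distr M config_space \<Phi>"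
    have distr: "\<P>(X in ?N. Q X) = \<P>(\<omega> in M. Q (\<Phi> \<omega>))" if "{X \<in> locally_finite_configs. Q X} \<in> sets config_space" for Q
      using measurable_space[OF \<Phi>] that
      by (subst measure_distr[OF \<Phi>]) (auto intro!: arg_cong[where f = "measure M"])
    show "prob_space ?N" using \<Phi> by (rule W.prob_space_distr)
    show "sets ?N = sets config_space" by simp
    {
      fix B :: "'a set" assume B: "B \<in> sets borel" "bounded B"
      let ?K = "{i. P i \<inter> B \<noteq> {}}"
      have PB: "P i \<inter> B \<in> sets borel" "bounded (P i \<inter> B)" for i using B Pb by (auto simp: bounded_Int)
      have "\<P>(X in ?N. X \<inter> B = {}) = \<P>(\<omega> in M. \<Phi> \<omega> \<inter> B = {})"
        using sets_Collect_void[OF refl B] by (intro distr) simp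
      also have "\<dots> = measure M {\<omega> \<in> space M. \<forall>i\<in>?K. \<omega> i \<in> {X \<in> space (NN i). X \<inter> (P i \<inter> B) = {}}}"
        by (intro arg_cong[where f = "measure M"]) (auto simp: void_iff space_M space_NN)
      also have "\<dots> = (\<Prod>i\<in>?K. measure (NN i) {X \<in> space (NN i). X \<inter> (P i \<inter> B) = {}})"
        by (rule prod_M[OF fin[OF B(2)]]) (rule sets_Collect_void[OF sets_NN PB])
      also have "\<dots> = (\<Prod>i\<in>?K. exp (- (l * measure lborel (P i \<inter> B))))"
        using NN B(1) by (intro prod.cong refl) (auto simp: cell_law_def)
      also have "\<dots> = exp (- (l * (\<Sum>i\<in>?K. measure lborel (P i \<inter> B))))"
        using fin[OF B(2)] by (simp add: exp_sum sum_distrib_left flip: sum_negf)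
      also have "(\<Sum>i\<in>?K. measure lborel (P i \<inter> B)) = measure lborel (\<Union>i\<in>?K. P i \<inter> B)"
        using disj PB emeasure_bounded_finite[OF PB(2)]
        by (intro measure_finite_Union[symmetric] fin B(2))
          (auto simp: disjoint_family_on_def less_top[symmetric])
      also have "(\<Union>i\<in>?K. P i \<inter> B) = B" using cover by blast
      finally show "\<P>(X in ?N. X \<inter> B = {}) = exp (- (l * measure lborel B))" .
    }
    have count: "\<P>(X in ?N. \<forall>j\<in>J. card (X \<inter> P j) \<in> C j) = (\<Prod>j\<in>J. measure (NN j) {X \<in> space (NN j). card (X \<inter> P j) \<in> C j})"
      if J: "finite J" for J C
    proof -
      have "{X \<in> space config_space. \<forall>j\<in>J. card (X \<inter> P j) \<in> C j} \<in> sets config_space"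
        by (rule sets.sets_Collect_finite_All[OF sets_Collect_card[OF refl Pb] J])
      then have "{X \<in> locally_finite_configs. \<forall>j\<in>J. card (X \<inter> P j) \<in> C j} \<in> sets config_space"
        by simp
      from distr[OF this] have "\<P>(X in ?N. \<forall>j\<in>J. card (X \<inter> P j) \<in> C j) = \<P>(\<omega> in M. \<forall>j\<in>J. card (\<Phi> \<omega> \<inter> P j) \<in> C j)" .
      also have "\<dots> = measure M {\<omega> \<in> space M. \<forall>j\<in>J. \<omega> j \<in> {X \<in> space (NN j). card (X \<inter> P j) \<in> C j}}"
        by (intro arg_cong[where f = "measure M"]) (auto simp: \<Phi>_P space_M space_NN)
      also have "\<dots> = (\<Prod>j\<in>J. measure (NN j) {X \<in> space (NN j). card (X \<inter> P j) \<in> C j})"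
        by (rule prod_M[OF J]) (rule sets_Collect_card[OF sets_NN Pb])
      finally show ?thesis .
    qed
    have count1: "\<P>(X in ?N. card (X \<inter> P j) \<in> C) = measure (NN j) {X \<in> space (NN j). card (X \<inter> P j) \<in> C}" for j C
      using count[of "{j}" "\<lambda>_. C"] by simp
    show "\<P>(X in ?N. card (X \<inter> P i) = n) = (l * measure lborel (P i)) ^ n / fact n * exp (- (l * measure lborel (P i)))" for i n
      using count1[of i "{n}"] NN[of i] by (simp add: cell_law_def)
    show "\<P>(X in ?N. \<forall>j\<in>J. card (X \<inter> P j) \<in> C j) = (\<Prod>j\<in>J. \<P>(X in ?N. card (X \<inter> P j) \<in> C j))"
      if "finite J" for J C
      unfolding count[OF that] count1 ..
  qed
qed

text \<open>The prescribed sets come first, numbered by \<open>g\<close>; the rest of the space is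
  cut into shells of width 1 around the origin, with the prescribed sets removed. A bounded set
  meets only finitely many shells.\<close>

lemma ex_bounded_partition:
  fixes \<B> :: "'a::euclidean_space set set"
  assumes \<B>: "finite \<B>" "disjoint \<B>" "\<And>B. B \<in> \<B> \<Longrightarrow> B \<in> sets borel \<and> bounded B"
  obtains P g where "bounded_partition P" "inj_on g \<B>" "\<And>B. B \<in> \<B> \<Longrightarrow> P (g B) = B"
proof -
  define m where "m = card \<B>"
  obtain g where g: "bij_betw g \<B> {0..<m}"
    using ex_bij_betw_finite_nat[OF \<B>(1)] by (auto simp: m_def)
  define h where "h = inv_into \<B> g"
  have h: "h k \<in> \<B>" "g (h k) = k" if "k < m" for k
    using g that bij_betwE[OF bij_betw_inv_into[OF g]] bij_betw_inv_into_right[OF g] by (auto simp: h_def)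
  have hg: "h (g B) = B" "g B < m" if "B \<in> \<B>" for B
    using g that bij_betw_inv_into_left[OF g] bij_betwE[OF g] by (auto simp: h_def)
  define Q :: "nat \<Rightarrow> 'a set" where "Q n = {x. real n \<le> norm x \<and> norm x < real n + 1}" for n
  define P where "P k = (if k < m then h k else Q (k - m) - \<Union>\<B>)" for k
  have Q_ball: "Q n \<subseteq> ball 0 (real n + 1)" for n by (auto simp: Q_def)
  have Q_borel: "Q n \<in> sets borel" for n
  proof -
    have "Q n = norm -` {real n..<real n + 1} \<inter> space borel" by (auto simp: Q_def)
    also have "\<dots> \<in> sets borel" by (rule measurable_sets[of norm borel borel]) auto
    finally show ?thesis .
  qed
  have Q_floor: "x \<in> Q n \<longleftrightarrow> n = nat \<lfloor>norm x\<rfloor>" for x n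
    by (auto simp: Q_def) linarith+
  have UB: "\<Union>\<B> \<in> sets borel" using \<B> by (intro sets.finite_Union) auto
  have "bounded_partition P"
    unfolding bounded_partition_def
  proof (intro conjI allI impI)
    show "disjoint_family P"
      unfolding disjoint_family_on_def
    proof (intro ballI impI)
      fix i j :: nat assume "i \<noteq> j"
      show "P i \<inter> P j = {}"
      proof (cases "i < m \<and> j < m")
        case True
        then have "h i \<noteq> h j" using h(2) \<open>i \<noteq> j\<close> by metis
        with True \<B>(2) h(1) show ?thesis by (auto simp: P_def disjoint_def)
      next
        case False
        then show ?thesis using h(1) \<open>i \<noteq> j\<close> by (auto simp: P_def Q_floor)
      qed
    qed
    show "(\<Union>i. P i) = UNIV"
    proof (intro equalityI subsetI UNIV_I)
      fix x :: 'a
      show "x \<in> (\<Union>i. P i)"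
      proof (cases "x \<in> \<Union>\<B>")
        case True
        then obtain B where "B \<in> \<B>" "x \<in> B" by auto
        then have "x \<in> P (g B)" using hg by (simp add: P_def)
        then show ?thesis by blast
      next
        case False
        then have "x \<in> P (m + nat \<lfloor>norm x\<rfloor>)" by (simp add: P_def Q_floor)
        then show ?thesis by blast
      qed
    qed
    fix i
    show "P i \<in> sets borel" using \<B>(3) h(1) Q_borel UB by (auto simp: P_def)
    show "bounded (P i)"
      using \<B>(3) h(1) bounded_subset[OF bounded_ball Q_ball] by (auto simp: P_def intro: bounded_diff bounded_subset)
  next
    fix B :: "'a set" assume "bounded B"
    then obtain r where r: "\<And>x. x \<in> B \<Longrightarrow> norm x \<le> r" by (auto simp: bounded_iff)
    have "{i. P i \<inter> B \<noteq> {}} \<subseteq> {..m + nat \<lfloor>r\<rfloor>}"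
    proof
      fix i assume "i \<in> {i. P i \<inter> B \<noteq> {}}"
      then obtain x where x: "x \<in> P i" "x \<in> B" by blast
      show "i \<in> {..m + nat \<lfloor>r\<rfloor>}"
      proof (cases "i < m")
        case False
        then have "i - m = nat \<lfloor>norm x\<rfloor>" using x(1) by (simp add: P_def Q_floor)
        also have "\<dots> \<le> nat \<lfloor>r\<rfloor>" using r[OF x(2)] by (intro nat_mono floor_mono)
        finally show ?thesis by simp
      qed simp
    qed
    then show "finite {i. P i \<inter> B \<noteq> {}}" by (rule finite_subset) simp
  qed
  moreover have "inj_on g \<B>" using g by (simp add: bij_betw_def)
  moreover have "P (g B) = B" if "B \<in> \<B>" for B using hg[OF that] by (simp add: P_def)
  ultimately show ?thesis using that by blast
qed

section \<open>Identification of the Poisson law by its void probabilities\<close>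

lemma poisson_point_process_void:
  assumes "poisson_point_process l N (\<lambda>X. X)" "sets N = sets config_space" "B \<in> sets borel" "bounded B"
  shows "\<P>(X in N. X \<inter> B = {}) = exp (- (l * measure lborel B))"
proof -
  have "space N = locally_finite_configs" using sets_eq_imp_space_eq[OF assms(2)] by simp
  then have "{X \<in> space N. X \<inter> B = {}} = {X \<in> space N. card (X \<inter> B) = 0}"
    using finite_Int_bounded[OF _ assms(4)] by auto
  moreover have "\<forall>B n. B \<in> sets borel \<and> bounded B \<longrightarrow>
        \<P>(\<omega> in N. card (\<omega> \<inter> B) = n) = (l * measure lborel B) ^ n / fact n * exp (- (l * measure lborel B))"
    using assms(1) by (simp add: poisson_point_process_def)
  ultimately show ?thesis using assms(3,4) by simp
qed

lemma ex_poisson_law: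
  assumes l: "l > 0"
  shows "\<exists>N :: 'a::euclidean_space set measure. sets N = sets config_space \<and> poisson_point_process l N (\<lambda>X. X)"
proof -
  \<comment> \<open>Any partition would do as a start; with no prescribed sets the shells alone are
    used.\<close>
  obtain P0 :: "nat \<Rightarrow> 'a set" where P0: "bounded_partition P0"
    using ex_bounded_partition[of "{} :: 'a set set"] by auto
  obtain N :: "'a set measure" where N: "prob_space N" "sets N = sets config_space"
    and void: "\<And>B. B \<in> sets borel \<Longrightarrow> bounded B \<Longrightarrow> \<P>(X in N. X \<inter> B = {}) = exp (- (l * measure lborel B))"
    by (rule superposition[OF P0 l]) (rule that; assumption)
  interpret N: prob_space N by fact
  \<comment> \<open>The law built from a partition adapted to \<open>\<B>\<close> has the same void
    probabilities as \<open>N\<close>, hence equals \<open>N\<close>. So the fixed law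
    \<open>N\<close> inherits the count law and the independence of the cells of every such
    partition.\<close>
  have transfer: "\<exists>(P :: nat \<Rightarrow> 'a set) g. inj_on g \<B> \<and> (\<forall>B\<in>\<B>. P (g B) = B) \<and>
      (\<forall>i n. \<P>(X in N. card (X \<inter> P i) = n) = (l * measure lborel (P i)) ^ n / fact n * exp (- (l * measure lborel (P i)))) \<and>
      (\<forall>J C. finite J \<longrightarrow> \<P>(X in N. \<forall>j\<in>J. card (X \<inter> P j) \<in> C j) = (\<Prod>j\<in>J. \<P>(X in N. card (X \<inter> P j) \<in> C j)))"
    if \<B>: "finite \<B>" "disjoint \<B>" "\<And>B. B \<in> \<B> \<Longrightarrow> B \<in> sets borel \<and> bounded B" for \<B> :: "'a set set"
  proof -
    obtain P :: "nat \<Rightarrow> 'a set" and g where P: "bounded_partition P" and g: "inj_on g \<B>" "\<And>B. B \<in> \<B> \<Longrightarrow> P (g B) = B"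
      using ex_bounded_partition[OF \<B>] by blast
    obtain N' where N': "prob_space N'" "sets N' = sets config_space"
      and void': "\<And>B. B \<in> sets borel \<Longrightarrow> bounded B \<Longrightarrow> \<P>(X in N'. X \<inter> B = {}) = exp (- (l * measure lborel B))"
      and count: "\<And>i n. \<P>(X in N'. card (X \<inter> P i) = n) = (l * measure lborel (P i)) ^ n / fact n * exp (- (l * measure lborel (P i)))"
      and prod: "\<And>J C. finite J \<Longrightarrow> \<P>(X in N'. \<forall>j\<in>J. card (X \<inter> P j) \<in> C j) = (\<Prod>j\<in>J. \<P>(X in N'. card (X \<inter> P j) \<in> C j))"
      by (rule superposition[OF P l]) (rule that; assumption)
    have "N = N'"
      using void void' by (intro config_measure_eqI N N') simp
    show ?thesis
      unfolding \<open>N = N'\<close>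
      by (rule exI[of _ P], rule exI[of _ g]) (intro conjI allI impI ballI g count prod)
  qed
  have "poisson_point_process l N (\<lambda>X. X)"
    unfolding poisson_point_process_def
  proof (intro conjI allI impI)
    show "prob_space N" by fact
    show "(\<lambda>X. X) \<in> measurable N config_space" using N(2) by simp
  next
    fix B :: "'a set" and n assume B: "B \<in> sets borel \<and> bounded B"
    obtain P :: "nat \<Rightarrow> 'a set" and g where "P (g B) = B"
      "\<And>i n. \<P>(X in N. card (X \<inter> P i) = n) = (l * measure lborel (P i)) ^ n / fact n * exp (- (l * measure lborel (P i)))"
      using transfer[of "{B}"] B by auto
    from this(2)[of "g B" n, unfolded this(1)]
    show "\<P>(X in N. card (X \<inter> B) = n) = (l * measure lborel B) ^ n / fact n * exp (- (l * measure lborel B))" .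
  next
    fix \<B> :: "'a set set" assume \<B>: "finite \<B> \<and> disjoint \<B> \<and> (\<forall>B\<in>\<B>. B \<in> sets borel \<and> bounded B)"
    obtain P :: "nat \<Rightarrow> 'a set" and g where g: "inj_on g \<B>" "\<forall>B\<in>\<B>. P (g B) = B"
      and prod: "\<And>J C. finite J \<Longrightarrow> \<P>(X in N. \<forall>j\<in>J. card (X \<inter> P j) \<in> C j) = (\<Prod>j\<in>J. \<P>(X in N. card (X \<inter> P j) \<in> C j))"
      using transfer[of \<B>] \<B> by blast
    show "N.indep_vars (\<lambda>_. count_space UNIV) (\<lambda>B X. card (X \<inter> B)) \<B>"
      unfolding N.indep_vars_def2
    proof (intro conjI ballI N.indep_setsI)
      fix B assume "B \<in> \<B>"
      then have B: "B \<in> sets borel" "bounded B" using \<B> by auto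
      show "(\<lambda>X. card (X \<inter> B)) \<in> measurable N (count_space UNIV)"
        using card_Int_measurable[OF B] N(2) by (simp cong: measurable_cong_sets)
      then show "{(\<lambda>X. card (X \<inter> B)) -` A \<inter> space N |A. A \<in> sets (count_space UNIV)} \<subseteq> N.events"
        by (auto intro: measurable_sets)
    next
      fix A and J assume J: "J \<noteq> {}" "J \<subseteq> \<B>" "finite J"
        and A: "\<forall>B\<in>J. A B \<in> {(\<lambda>X. card (X \<inter> B)) -` A \<inter> space N |A. A \<in> sets (count_space UNIV)}"
      have "\<forall>B\<in>J. \<exists>C. A B = {X \<in> space N. card (X \<inter> B) \<in> C}"
      proof
        fix B assume "B \<in> J"
        with A obtain C where "A B = (\<lambda>X. card (X \<inter> B)) -` C \<inter> space N" by blast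
        also have "\<dots> = {X \<in> space N. card (X \<inter> B) \<in> C}" by auto
        finally show "\<exists>C. A B = {X \<in> space N. card (X \<inter> B) \<in> C}" by blast
      qed
      from bchoice[OF this] obtain C where C: "\<And>B. B \<in> J \<Longrightarrow> A B = {X \<in> space N. card (X \<inter> B) \<in> C B}" by blast
      \<comment> \<open>Cells are indexed by numbers, but the counts of a Poisson process by the
        sets themselves; injectivity of \<open>g\<close> lets the product over cell numbers be
        rewritten as one over \<open>J\<close>.\<close>
      have inj: "inj_on g J" using g(1) J(2) by (rule inj_on_subset)
      have Pg: "P (g B) = B" if "B \<in> J" for B using g(2) J(2) that by auto
      have "(\<Inter>B\<in>J. A B) = {X \<in> space N. \<forall>k\<in>g ` J. card (X \<inter> P k) \<in> C (P k)}"
        using J(1) C Pg by auto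
      then have "N.prob (\<Inter>B\<in>J. A B) = (\<Prod>k\<in>g ` J. \<P>(X in N. card (X \<inter> P k) \<in> C (P k)))"
        using prod[of "g ` J" "\<lambda>k. C (P k)"] J(3) by simp
      also have "\<dots> = (\<Prod>B\<in>J. N.prob (A B))"
        using C Pg by (simp add: prod.reindex[OF inj])
      finally show "N.prob (\<Inter>B\<in>J. A B) = (\<Prod>B\<in>J. N.prob (A B))" .
    qed
  qed
  with N(2) show ?thesis by blast
qed

text \<open>Unique existence gives the definite description in \<open>poisson_law\<close> its
  intended meaning. For uniqueness the count formula is applied at zero points: it fixes the void
  probabilities, and these fix the law.\<close>

theorem poisson_law:
  assumes "l > 0"
  shows sets_poisson_law: "sets (poisson_law l :: 'a::euclidean_space set measure) = sets config_space"
    and poisson_point_process_poisson_law: "poisson_point_process l (poisson_law l :: 'a set measure) (\<lambda>X. X)"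
proof -
  have "\<exists>!N :: 'a set measure. sets N = sets config_space \<and> poisson_point_process l N (\<lambda>X. X)"
  proof (rule ex_ex1I[OF ex_poisson_law[OF assms]])
    fix N N' :: "'a set measure"
    assume N: "sets N = sets config_space \<and> poisson_point_process l N (\<lambda>X. X)"
      and N': "sets N' = sets config_space \<and> poisson_point_process l N' (\<lambda>X. X)"
    then have "prob_space N" "prob_space N'" by (auto simp: poisson_point_process_def)
    then show "N = N'"
      using N N' by (intro config_measure_eqI) (simp_all add: poisson_point_process_void[of l N] poisson_point_process_void[of l N'])
  qed
  from theI'[OF this, folded poisson_law_def]
  show "sets (poisson_law l :: 'a set measure) = sets config_space"
    "poisson_point_process l (poisson_law l :: 'a set measure) (\<lambda>X. X)" by auto
qed

section \<open>Measurability of AB percolation\<close>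

text \<open>A countable base yields a measurable enumeration of the points of a configuration: the
  \<open>B\<close>-labelled point exists when exactly one point of the configuration lies in \<open>B\<close>.\<close>

definition the_point :: "'a set \<Rightarrow> 'a set \<Rightarrow> 'a" where
  "the_point B X = the_elem (X \<inter> B)"

lemma the_point_in:
  assumes "card (X \<inter> B) = 1"
  shows "the_point B X \<in> X" "the_point B X \<in> B" "X \<inter> B = {the_point B X}"
proof -
  obtain x where x: "X \<inter> B = {x}" using assms by (rule card_1_singletonE)
  then have "the_point B X = x" by (simp add: the_point_def)
  then show "the_point B X \<in> X" "the_point B X \<in> B" "X \<inter> B = {the_point B X}" using x by blast+
qed

text \<open>Counts in the base sets will serve as measurable data, and for this the base sets have
  to be bounded.\<close>

definition bounded_basis :: "'a::euclidean_space set set \<Rightarrow> bool" where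
  "bounded_basis \<BB> \<longleftrightarrow> countable \<BB> \<and> (\<forall>B\<in>\<BB>. open B \<and> bounded B) \<and>
     (\<forall>x U. open U \<and> x \<in> U \<longrightarrow> (\<exists>B\<in>\<BB>. x \<in> B \<and> B \<subseteq> U))"

lemma ex_bounded_basis: "\<exists>\<BB> :: 'a::euclidean_space set set. bounded_basis \<BB>"
proof -
  obtain \<BB> :: "'a set set" where \<BB>: "countable \<BB>" "topological_basis \<BB>"
    using ex_countable_basis by blast
  have "bounded_basis {B \<in> \<BB>. bounded B}"
    unfolding bounded_basis_def
  proof (intro conjI allI impI ballI)
    show "countable {B \<in> \<BB>. bounded B}" using \<BB>(1) by (rule countable_subset[rotated]) auto
    fix x :: 'a and U assume "open U \<and> x \<in> U"
    then have "open (U \<inter> ball x 1)" "x \<in> U \<inter> ball x 1" by auto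
    from topological_basisE[OF \<BB>(2) this] obtain B where B: "B \<in> \<BB>" "x \<in> B" "B \<subseteq> U \<inter> ball x 1" .
    moreover have "bounded B" using bounded_subset[OF bounded_ball[of x 1]] B(3) by blast
    ultimately show "\<exists>B\<in>{B \<in> \<BB>. bounded B}. x \<in> B \<and> B \<subseteq> U" by blast
  qed (use \<BB>(2) in \<open>auto intro: topological_basis_open\<close>)
  then show ?thesis by blast
qed

text \<open>Removing from the unit ball around \<open>x\<close> its finitely many other points of
  \<open>X\<close> leaves an open neighbourhood, and a base set inside it isolates
  \<open>x\<close>.\<close>

lemma ex_label:
  assumes \<BB>: "bounded_basis \<BB>" and X: "X \<in> locally_finite_configs" and x: "x \<in> X"
  shows "\<exists>B\<in>\<BB>. card (X \<inter> B) = 1 \<and> the_point B X = x"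
proof -
  have "finite (X \<inter> ball x 1 - {x})" using finite_Int_bounded[OF X, of "ball x 1"] by simp
  then have "open (ball x 1 - (X \<inter> ball x 1 - {x}))" by (intro open_Diff finite_imp_closed) auto
  moreover have "x \<in> ball x 1 - (X \<inter> ball x 1 - {x})" by simp
  ultimately obtain B where B: "B \<in> \<BB>" "x \<in> B" "B \<subseteq> ball x 1 - (X \<inter> ball x 1 - {x})"
    using \<BB> unfolding bounded_basis_def by blast
  then have "X \<inter> B = {x}" using x by auto
  with B(1) show ?thesis by (intro bexI[of _ B]) (auto simp: the_point_def)
qed

lemma pred_card_Int:
  assumes "\<xi> \<in> measurable M config_space" "B \<in> sets borel" "bounded B"
  shows "Measurable.pred M (\<lambda>\<omega>. card (\<xi> \<omega> \<inter> B) = n)"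
proof -
  have "(\<lambda>\<omega>. card (\<xi> \<omega> \<inter> B)) \<in> measurable M (count_space UNIV)"
    by (rule measurable_compose[OF assms(1) card_Int_measurable[OF assms(2,3)]])
  then show ?thesis by measurable
qed

text \<open>When \<open>B\<close> contains exactly one point, that point lies in \<open>C\<close>
  iff \<open>B \<inter> C\<close> also contains exactly one, so preimages are described by counts.
  The value 0 elsewhere is a default.\<close>

lemma measurable_the_point:
  fixes B :: "'a::euclidean_space set"
  assumes \<xi>: "\<xi> \<in> measurable M config_space" and B: "B \<in> sets borel" "bounded B"
  shows "(\<lambda>\<omega>. if card (\<xi> \<omega> \<inter> B) = 1 then the_point B (\<xi> \<omega>) else 0) \<in> borel_measurable M"
proof (rule measurableI)
  fix C :: "'a set" assume C: "C \<in> sets borel"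
  let ?f = "\<lambda>\<omega>. if card (\<xi> \<omega> \<inter> B) = 1 then the_point B (\<xi> \<omega>) else 0"
  have "the_point B X \<in> C \<longleftrightarrow> card (X \<inter> (B \<inter> C)) = 1" if "card (X \<inter> B) = 1" for X
  proof -
    have "X \<inter> (B \<inter> C) = {the_point B X} \<inter> C"
      unfolding the_point_in(3)[OF that, symmetric] by blast
    then show ?thesis by (cases "the_point B X \<in> C") simp_all
  qed
  then have "?f -` C \<inter> space M = {\<omega> \<in> space M. if card (\<xi> \<omega> \<inter> B) = 1 then card (\<xi> \<omega> \<inter> (B \<inter> C)) = 1 else 0 \<in> C}"
    by auto
  moreover have "Measurable.pred M (\<lambda>\<omega>. if card (\<xi> \<omega> \<inter> B) = 1 then card (\<xi> \<omega> \<inter> (B \<inter> C)) = 1 else 0 \<in> C)"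
    unfolding if_bool_eq_conj
    using pred_card_Int[OF \<xi> B] pred_card_Int[OF \<xi>, of "B \<inter> C"] B C
    by (intro pred_intros_logic(2,3,4)) (auto simp: bounded_Int)
  ultimately show "?f -` C \<inter> space M \<in> sets M" by (simp add: pred_def)
qed simp

text \<open>Reachability is a countable union over the path length, and each further step is a
  countable union over the intermediate vertex.\<close>

lemma pred_rtrancl:
  fixes R :: "'w \<Rightarrow> ('i \<times> 'i) set"
  assumes I: "countable I" "\<And>\<omega>. \<omega> \<in> space M \<Longrightarrow> R \<omega> \<subseteq> I \<times> I"
    and R: "\<And>i j. i \<in> I \<Longrightarrow> j \<in> I \<Longrightarrow> Measurable.pred M (\<lambda>\<omega>. (i, j) \<in> R \<omega>)"
    and ij: "i \<in> I" "j \<in> I"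
  shows "Measurable.pred M (\<lambda>\<omega>. (i, j) \<in> (R \<omega>)\<^sup>*)"
proof -
  have pow: "Measurable.pred M (\<lambda>\<omega>. (i, j) \<in> R \<omega> ^^ n)" if "j \<in> I" for n j
    using that
  proof (induction n arbitrary: j)
    case (Suc n)
    have "Measurable.pred M (\<lambda>\<omega>. \<exists>k\<in>I. (i, k) \<in> R \<omega> ^^ n \<and> (k, j) \<in> R \<omega>)"
      using Suc R by (intro pred_countable_Bex[OF I(1)] pred_intros_logic) auto
    moreover have "(i, j) \<in> R \<omega> ^^ Suc n \<longleftrightarrow> (\<exists>k\<in>I. (i, k) \<in> R \<omega> ^^ n \<and> (k, j) \<in> R \<omega>)" if "\<omega> \<in> space M" for \<omega>
      using I(2)[OF that] by auto
    ultimately show ?case by (rule measurable_cong[THEN iffD2, rotated])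
  qed auto
  have "Measurable.pred M (\<lambda>\<omega>. \<exists>n. (i, j) \<in> R \<omega> ^^ n)"
    using pow[OF ij(2)] by (intro pred_intros_countable)
  then show ?thesis by (simp add: rtrancl_is_UN_relpow)
qed

lemma percolates_iff:
  "percolates V E \<longleftrightarrow> (\<exists>x\<in>V. infinite {y\<in>V. (x, y) \<in> E\<^sup>*})"
  unfolding percolates_def graph_components_def quotient_def by auto

text \<open>Random vertices are replaced by a fixed countable set of labels. A point may have many
  labels, so an infinite set of reachable labels would prove nothing; instead the reachable points
  must be unbounded, which for subsets of a locally finite configuration is the same as being
  infinite.\<close>

lemma percolates_AB_iff:
  fixes X Y :: "'a::euclidean_space set" and r :: real
  assumes \<BB>: "bounded_basis \<BB>" and XY: "X \<in> locally_finite_configs" "Y \<in> locally_finite_configs"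
  defines "R \<equiv> {(A, B). A \<in> \<BB> \<and> B \<in> \<BB> \<and> card (X \<inter> A) = 1 \<and> card (X \<inter> B) = 1 \<and> the_point A X \<noteq> the_point B X \<and>
    (\<exists>D\<in>\<BB>. card (Y \<inter> D) = 1 \<and> dist (the_point A X) (the_point D Y) \<le> 2 * r \<and> dist (the_point B X) (the_point D Y) \<le> 2 * r)}"
  shows "percolates X (AB_edges r X Y) \<longleftrightarrow>
    (\<exists>A\<in>\<BB>. card (X \<inter> A) = 1 \<and> (\<forall>n::nat. \<exists>B\<in>\<BB>. (A, B) \<in> R\<^sup>* \<and> card (X \<inter> B) = 1 \<and> real n \<le> norm (the_point B X)))"
proof -
  let ?E = "AB_edges r X Y"
  have R_iff: "(A, B) \<in> R \<longleftrightarrow> A \<in> \<BB> \<and> B \<in> \<BB> \<and> card (X \<inter> A) = 1 \<and> card (X \<inter> B) = 1 \<and> (the_point A X, the_point B X) \<in> ?E" for A B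
  proof -
    have "(\<exists>D\<in>\<BB>. card (Y \<inter> D) = 1 \<and> Q (the_point D Y)) \<longleftrightarrow> (\<exists>y\<in>Y. Q y)" for Q
      using ex_label[OF \<BB> XY(2)] the_point_in(1) by metis
    from this[of "\<lambda>y. dist (the_point A X) y \<le> 2 * r \<and> dist (the_point B X) y \<le> 2 * r"]
    show ?thesis unfolding R_def AB_edges_def using the_point_in(1) by auto
  qed
  have to_E: "(the_point A X, the_point B X) \<in> ?E\<^sup>*" if "(A, B) \<in> R\<^sup>*" for A B
    using that by induction (auto simp: R_iff intro: rtrancl.rtrancl_into_rtrancl)
  have from_E: "\<exists>B\<in>\<BB>. card (X \<inter> B) = 1 \<and> the_point B X = y \<and> (A, B) \<in> R\<^sup>*"
    if "(the_point A X, y) \<in> ?E\<^sup>*" "A \<in> \<BB>" "card (X \<inter> A) = 1" for A y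
    using that(1)
  proof induction
    case base
    then show ?case using that(2,3) by auto
  next
    case (step y z)
    then obtain B where B: "B \<in> \<BB>" "card (X \<inter> B) = 1" "the_point B X = y" "(A, B) \<in> R\<^sup>*" by blast
    have "z \<in> X" using step(2) by (auto simp: AB_edges_def)
    from ex_label[OF \<BB> XY(1) this] obtain C where C: "C \<in> \<BB>" "card (X \<inter> C) = 1" "the_point C X = z" by blast
    have "(B, C) \<in> R" using B C step(2) by (simp add: R_iff)
    with B(4) have "(A, C) \<in> R\<^sup>*" by (rule rtrancl.rtrancl_into_rtrancl)
    with C show ?case by blast
  qed
  have infinite_iff: "infinite S \<longleftrightarrow> (\<forall>n::nat. \<exists>y\<in>S. real n \<le> norm y)" if "S \<subseteq> X" for S
  proof
    assume inf: "infinite S"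
    show "\<forall>n::nat. \<exists>y\<in>S. real n \<le> norm y"
    proof (rule ccontr)
      assume "\<not> (\<forall>n::nat. \<exists>y\<in>S. real n \<le> norm y)"
      then obtain n :: nat where "\<And>y. y \<in> S \<Longrightarrow> norm y < real n" by (auto simp: not_le)
      then have "S \<subseteq> X \<inter> ball 0 (real n)" using that by auto
      then show False using inf finite_Int_bounded[OF XY(1) bounded_ball] finite_subset by blast
    qed
  next
    assume *: "\<forall>n::nat. \<exists>y\<in>S. real n \<le> norm y"
    show "infinite S"
    proof
      assume "finite S"
      then obtain b where b: "\<And>y. y \<in> S \<Longrightarrow> norm y \<le> b" using finite_imp_bounded bounded_iff by metis
      obtain n :: nat where "b < real n" using reals_Archimedean2 by blast
      with * b show False by (meson not_le order_trans)
    qed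
  qed
  have comp: "infinite {y\<in>X. (the_point A X, y) \<in> ?E\<^sup>*} \<longleftrightarrow>
      (\<forall>n::nat. \<exists>B\<in>\<BB>. (A, B) \<in> R\<^sup>* \<and> card (X \<inter> B) = 1 \<and> real n \<le> norm (the_point B X))"
    if A: "A \<in> \<BB>" "card (X \<inter> A) = 1" for A
  proof -
    have "(\<exists>y\<in>{y\<in>X. (the_point A X, y) \<in> ?E\<^sup>*}. real n \<le> norm y) \<longleftrightarrow>
        (\<exists>B\<in>\<BB>. (A, B) \<in> R\<^sup>* \<and> card (X \<inter> B) = 1 \<and> real n \<le> norm (the_point B X))" for n :: nat
    proof
      assume "\<exists>y\<in>{y\<in>X. (the_point A X, y) \<in> ?E\<^sup>*}. real n \<le> norm y"
      then show "\<exists>B\<in>\<BB>. (A, B) \<in> R\<^sup>* \<and> card (X \<inter> B) = 1 \<and> real n \<le> norm (the_point B X)"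
        using from_E[OF _ A] by blast
    next
      assume "\<exists>B\<in>\<BB>. (A, B) \<in> R\<^sup>* \<and> card (X \<inter> B) = 1 \<and> real n \<le> norm (the_point B X)"
      then show "\<exists>y\<in>{y\<in>X. (the_point A X, y) \<in> ?E\<^sup>*}. real n \<le> norm y"
        using to_E the_point_in(1) by blast
    qed
    then show ?thesis by (subst infinite_iff) auto
  qed
  have "percolates X ?E \<longleftrightarrow> (\<exists>x\<in>X. infinite {y\<in>X. (x, y) \<in> ?E\<^sup>*})"
    by (rule percolates_iff)
  also have "\<dots> \<longleftrightarrow> (\<exists>A\<in>\<BB>. card (X \<inter> A) = 1 \<and> infinite {y\<in>X. (the_point A X, y) \<in> ?E\<^sup>*})"
  proof
    assume "\<exists>x\<in>X. infinite {y\<in>X. (x, y) \<in> ?E\<^sup>*}"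
    then obtain x where x: "x \<in> X" "infinite {y\<in>X. (x, y) \<in> ?E\<^sup>*}" by blast
    from ex_label[OF \<BB> XY(1) x(1)] obtain A where "A \<in> \<BB>" "card (X \<inter> A) = 1" "the_point A X = x" by blast
    with x(2) show "\<exists>A\<in>\<BB>. card (X \<inter> A) = 1 \<and> infinite {y\<in>X. (the_point A X, y) \<in> ?E\<^sup>*}"
      by (intro bexI[of _ A]) simp_all
  qed (use the_point_in(1) in blast)
  finally show ?thesis using comp by (simp cong: bex_cong conj_cong)
qed

text \<open>AB percolation will be the larger side of an inclusion of events, and monotonicity of
  the measure asks for the larger event to be measurable.\<close>

lemma measurable_percolates_AB:
  "Measurable.pred (config_space \<Otimes>\<^sub>M config_space)
     (\<lambda>(X, Y :: 'a::euclidean_space set). percolates X (AB_edges r X Y))"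
proof -
  let ?M = "config_space \<Otimes>\<^sub>M config_space :: ('a set \<times> 'a set) measure"
  obtain \<BB> :: "'a set set" where \<BB>: "bounded_basis \<BB>" using ex_bounded_basis by blast
  have cnt: "countable \<BB>" and B_sets: "\<And>B. B \<in> \<BB> \<Longrightarrow> B \<in> sets borel" "\<And>B. B \<in> \<BB> \<Longrightarrow> bounded B"
    using \<BB> by (auto simp: bounded_basis_def)
  \<comment> \<open>A total version of \<open>the_point\<close> with default value 0. In the graph
    and in the percolation criterion it occurs together with the condition that the base set holds
    exactly one point, so the default does no harm.\<close>
  define f where "f B X = (if card (X \<inter> B) = 1 then the_point B X else 0)" for B X :: "'a set"
  have fst_f [measurable]: "(\<lambda>\<omega>. f B (fst \<omega>)) \<in> borel_measurable ?M" if "B \<in> \<BB>" for B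
    unfolding f_def by (rule measurable_the_point[OF measurable_fst B_sets[OF that]])
  have snd_f [measurable]: "(\<lambda>\<omega>. f B (snd \<omega>)) \<in> borel_measurable ?M" if "B \<in> \<BB>" for B
    unfolding f_def by (rule measurable_the_point[OF measurable_snd B_sets[OF that]])
  have fst_card: "Measurable.pred ?M (\<lambda>\<omega>. card (fst \<omega> \<inter> B) = 1)" if "B \<in> \<BB>" for B
    by (rule pred_card_Int[OF measurable_fst B_sets[OF that]])
  have snd_card: "Measurable.pred ?M (\<lambda>\<omega>. card (snd \<omega> \<inter> B) = 1)" if "B \<in> \<BB>" for B
    by (rule pred_card_Int[OF measurable_snd B_sets[OF that]])
  define R where "R \<omega> = {(A, B). A \<in> \<BB> \<and> B \<in> \<BB> \<and> card (fst \<omega> \<inter> A) = 1 \<and> card (fst \<omega> \<inter> B) = 1 \<and>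
    f A (fst \<omega>) \<noteq> f B (fst \<omega>) \<and> (\<exists>D\<in>\<BB>. card (snd \<omega> \<inter> D) = 1 \<and>
      dist (f A (fst \<omega>)) (f D (snd \<omega>)) \<le> 2 * r \<and> dist (f B (fst \<omega>)) (f D (snd \<omega>)) \<le> 2 * r)}" for \<omega> :: "'a set \<times> 'a set"
  have R: "Measurable.pred ?M (\<lambda>\<omega>. (A, B) \<in> R \<omega>)" if AB: "A \<in> \<BB>" "B \<in> \<BB>" for A B
  proof -
    have "Measurable.pred ?M (\<lambda>\<omega>. card (fst \<omega> \<inter> A) = 1 \<and> card (fst \<omega> \<inter> B) = 1 \<and>
      f A (fst \<omega>) \<noteq> f B (fst \<omega>) \<and> (\<exists>D\<in>\<BB>. card (snd \<omega> \<inter> D) = 1 \<and>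
      dist (f A (fst \<omega>)) (f D (snd \<omega>)) \<le> 2 * r \<and> dist (f B (fst \<omega>)) (f D (snd \<omega>)) \<le> 2 * r))"
    proof (intro pred_intros_logic(3) fst_card AB pred_countable_Bex[OF cnt] snd_card)
      show "Measurable.pred ?M (\<lambda>\<omega>. f A (fst \<omega>) \<noteq> f B (fst \<omega>))"
        using fst_f[OF AB(1)] fst_f[OF AB(2)] by measurable
      fix D assume D: "D \<in> \<BB>"
      show "Measurable.pred ?M (\<lambda>\<omega>. dist (f A (fst \<omega>)) (f D (snd \<omega>)) \<le> 2 * r)"
        using fst_f[OF AB(1)] snd_f[OF D] by measurable
      show "Measurable.pred ?M (\<lambda>\<omega>. dist (f B (fst \<omega>)) (f D (snd \<omega>)) \<le> 2 * r)"
        using fst_f[OF AB(2)] snd_f[OF D] by measurable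
    qed
    then show ?thesis using AB by (simp add: R_def)
  qed
  have reach: "Measurable.pred ?M (\<lambda>\<omega>. (A, B) \<in> (R \<omega>)\<^sup>*)" if "A \<in> \<BB>" "B \<in> \<BB>" for A B
    by (rule pred_rtrancl[OF cnt _ R that]) (auto simp: R_def)
  have "Measurable.pred ?M (\<lambda>\<omega>. \<exists>A\<in>\<BB>. card (fst \<omega> \<inter> A) = 1 \<and>
      (\<forall>n::nat. \<exists>B\<in>\<BB>. (A, B) \<in> (R \<omega>)\<^sup>* \<and> card (fst \<omega> \<inter> B) = 1 \<and> real n \<le> norm (f B (fst \<omega>))))"
  proof (intro pred_intros_logic(3) pred_intros_countable(1) fst_card pred_countable_Bex[OF cnt] reach)
    fix n :: nat and B assume "B \<in> \<BB>"
    from fst_f[OF this] show "Measurable.pred ?M (\<lambda>\<omega>. real n \<le> norm (f B (fst \<omega>)))" by measurable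
  qed
  moreover have "percolates (fst \<omega>) (AB_edges r (fst \<omega>) (snd \<omega>)) \<longleftrightarrow> (\<exists>A\<in>\<BB>. card (fst \<omega> \<inter> A) = 1 \<and>
      (\<forall>n::nat. \<exists>B\<in>\<BB>. (A, B) \<in> (R \<omega>)\<^sup>* \<and> card (fst \<omega> \<inter> B) = 1 \<and> real n \<le> norm (f B (fst \<omega>))))"
    if "\<omega> \<in> space ?M" for \<omega>
  proof -
    have "fst \<omega> \<in> locally_finite_configs" "snd \<omega> \<in> locally_finite_configs"
      using that by (auto simp: space_pair_measure)
    moreover have "R \<omega> = {(A, B). A \<in> \<BB> \<and> B \<in> \<BB> \<and> card (fst \<omega> \<inter> A) = 1 \<and> card (fst \<omega> \<inter> B) = 1 \<and>
        the_point A (fst \<omega>) \<noteq> the_point B (fst \<omega>) \<and> (\<exists>D\<in>\<BB>. card (snd \<omega> \<inter> D) = 1 \<and>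
        dist (the_point A (fst \<omega>)) (the_point D (snd \<omega>)) \<le> 2 * r \<and> dist (the_point B (fst \<omega>)) (the_point D (snd \<omega>)) \<le> 2 * r)}"
      unfolding R_def f_def by (intro Collect_cong) (auto split: if_splits)
    moreover have "card (fst \<omega> \<inter> B) = 1 \<and> real n \<le> norm (f B (fst \<omega>)) \<longleftrightarrow>
        card (fst \<omega> \<inter> B) = 1 \<and> real n \<le> norm (the_point B (fst \<omega>))" for n B
      by (auto simp: f_def)
    ultimately show ?thesis using percolates_AB_iff[OF \<BB>, of "fst \<omega>" "snd \<omega>" r] by simp
  qed
  ultimately show ?thesis
    unfolding case_prod_beta by (rule measurable_cong[THEN iffD2, rotated])
qed

section \<open>Site percolation\<close>

lemma space_poisson_law [simp]: "l > 0 \<Longrightarrow> space (poisson_law l :: 'a::euclidean_space set measure) = locally_finite_configs"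
  using sets_eq_imp_space_eq[OF sets_poisson_law[of l]] by simp

lemma prob_space_poisson_law: "l > 0 \<Longrightarrow> prob_space (poisson_law l :: 'a::euclidean_space set measure)"
  using poisson_point_process_poisson_law[of l] by (auto simp: poisson_point_process_def)

text \<open>The independence of counts is indexed by the sets themselves. Nonempty disjoint sets are
  distinct, so \<open>B\<close> is injective on \<open>J\<close> and the product over sets becomes a
  product over indices.\<close>

lemma poisson_law_hits:
  fixes B :: "'i \<Rightarrow> 'a::euclidean_space set"
  assumes l: "l > 0" and J: "finite J" "disjoint_family_on B J"
    and B: "\<And>i. i \<in> J \<Longrightarrow> B i \<in> sets borel" "\<And>i. i \<in> J \<Longrightarrow> bounded (B i)" "\<And>i. i \<in> J \<Longrightarrow> B i \<noteq> {}"
  shows "\<P>(X in poisson_law l. \<forall>i\<in>J. X \<inter> B i \<noteq> {}) = (\<Prod>i\<in>J. 1 - exp (- (l * measure lborel (B i))))"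
proof (cases "J = {}")
  case True
  interpret prob_space "poisson_law l :: 'a set measure" using l by (rule prob_space_poisson_law)
  show ?thesis using True prob_space by simp
next
  case False
  let ?N = "poisson_law l :: 'a set measure"
  interpret prob_space ?N using l by (rule prob_space_poisson_law)
  have ppp: "poisson_point_process l ?N (\<lambda>X. X)" using l by (rule poisson_point_process_poisson_law)
  have inj: "inj_on B J"
  proof (rule inj_onI, rule ccontr)
    fix i j assume ij: "i \<in> J" "j \<in> J" "B i = B j" "i \<noteq> j"
    with disjoint_family_onD[OF J(2), of i j] B(3) show False by auto
  qed
  have "finite (B ` J) \<and> disjoint (B ` J) \<and> (\<forall>C\<in>B ` J. C \<in> sets borel \<and> bounded C)"
    using J B(1,2) by (auto simp: disjoint_family_on_disjoint_image)
  then have ind: "indep_vars (\<lambda>_. count_space UNIV) (\<lambda>C X. card (X \<inter> C)) (B ` J)"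
    using ppp by (simp add: poisson_point_process_def)
  have hit_iff: "(\<lambda>X. card (X \<inter> C)) -` (- {0}) \<inter> space ?N = {X \<in> space ?N. X \<inter> C \<noteq> {}}" if "C \<in> B ` J" for C
  proof -
    have "bounded C" using that B(2) by auto
    then have "card (X \<inter> C) = 0 \<longleftrightarrow> X \<inter> C = {}" if "X \<in> space ?N" for X
      using finite_Int_bounded[of X C] that l by simp
    then show ?thesis by auto
  qed
  have hit: "prob {X \<in> space ?N. X \<inter> C \<noteq> {}} = 1 - exp (- (l * measure lborel C))" if "C \<in> B ` J" for C
  proof -
    have C: "C \<in> sets borel" "bounded C" using that B by auto
    have "{X \<in> space ?N. X \<inter> C \<noteq> {}} = space ?N - {X \<in> space ?N. X \<inter> C = {}}" by auto
    then show ?thesis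
      using prob_compl[OF sets_Collect_void[OF sets_poisson_law[OF l] C]]
        poisson_point_process_void[OF ppp sets_poisson_law[OF l] C] by simp
  qed
  have "{X \<in> space ?N. \<forall>i\<in>J. X \<inter> B i \<noteq> {}} = (\<Inter>C\<in>B ` J. {X \<in> space ?N. X \<inter> C \<noteq> {}})"
    using False by auto
  also have "\<dots> = (\<Inter>C\<in>B ` J. (\<lambda>X. card (X \<inter> C)) -` (- {0}) \<inter> space ?N)"
    by (intro INF_cong refl hit_iff[symmetric])
  also have "prob \<dots> = (\<Prod>C\<in>B ` J. prob ((\<lambda>X. card (X \<inter> C)) -` (- {0}) \<inter> space ?N))"
    using J(1) False by (intro indep_varsD_finite[OF ind]) auto
  also have "\<dots> = (\<Prod>C\<in>B ` J. 1 - exp (- (l * measure lborel C)))"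
    by (intro prod.cong refl) (simp only: hit_iff hit)
  also have "\<dots> = (\<Prod>i\<in>J. 1 - exp (- (l * measure lborel (B i))))"
    by (simp add: prod.reindex[OF inj])
  finally show ?thesis .
qed

section \<open>Laws of random sets of open sites\<close>

abbreviation site_space :: "('i \<Rightarrow> bool) measure" where
  "site_space \<equiv> \<Pi>\<^sub>M i\<in>UNIV. count_space UNIV"

lemma space_site_space: "space site_space = UNIV"
  by (simp add: space_PiM)

text \<open>The events that all sites of a finite set are open are stable under intersection and
  generate the product sigma-algebra, so their probabilities determine the law.\<close>

lemma site_law_eqI:
  fixes \<xi> :: "'w \<Rightarrow> 'i \<Rightarrow> bool" and \<eta> :: "'v \<Rightarrow> 'i \<Rightarrow> bool"
  assumes M: "prob_space M" "prob_space N"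
    and \<xi>: "\<And>i. Measurable.pred M (\<lambda>\<omega>. \<xi> \<omega> i)" and \<eta>: "\<And>i. Measurable.pred N (\<lambda>\<omega>. \<eta> \<omega> i)"
    and eq: "\<And>J. finite J \<Longrightarrow> \<P>(\<omega> in M. \<forall>i\<in>J. \<xi> \<omega> i) = \<P>(\<omega> in N. \<forall>i\<in>J. \<eta> \<omega> i)"
    and Q: "Measurable.pred site_space Q"
  shows "\<P>(\<omega> in M. Q (\<xi> \<omega>)) = \<P>(\<omega> in N. Q (\<eta> \<omega>))"
proof -
  interpret M: prob_space M by fact
  interpret N: prob_space N by fact
  have \<xi>_meas: "\<xi> \<in> measurable M site_space" and \<eta>_meas: "\<eta> \<in> measurable N site_space"
    using \<xi> \<eta> by (auto intro!: measurable_PiM_single')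
  define E :: "('i \<Rightarrow> bool) set set" where "E = {{f. \<forall>i\<in>J. f i} | J. finite J}"
  have E_sets: "{f. \<forall>i\<in>J. f i} \<in> sets (site_space :: ('i \<Rightarrow> bool) measure)" if "finite J" for J
  proof -
    have "Measurable.pred site_space (\<lambda>f :: 'i \<Rightarrow> bool. \<forall>i\<in>J. f i)"
      by (intro pred_intros_finite(3) that measurable_component_singleton) simp
    then show ?thesis by (simp add: pred_def space_site_space)
  qed
  define V where "V = sigma UNIV E"
  have V: "sets V = sigma_sets UNIV E" "space V = UNIV" by (auto simp: V_def)
  have "(\<lambda>f. f) \<in> measurable V (site_space :: ('i \<Rightarrow> bool) measure)"
  proof (rule measurable_PiM_single')
    fix i :: 'i
    have "{f. \<forall>j\<in>{i}. f j} \<in> sets V" unfolding V E_def by (rule sigma_sets.Basic) blast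
    then show "(\<lambda>f. f i) \<in> measurable V (count_space UNIV)" by (simp add: pred_def V)
  qed simp
  from measurable_sets[OF this] have "sets (site_space :: ('i \<Rightarrow> bool) measure) \<subseteq> sets V" by (auto simp: V)
  moreover have "sigma_sets UNIV E \<subseteq> sets (site_space :: ('i \<Rightarrow> bool) measure)"
    using sets.sigma_sets_subset[of E site_space] E_sets by (auto simp: E_def space_site_space)
  ultimately have gen: "sets (site_space :: ('i \<Rightarrow> bool) measure) = sigma_sets UNIV E" by (simp add: V)
  have "distr M site_space \<xi> = distr N site_space \<eta>"
  proof (rule measure_eqI_generator_eq[where E = E and \<Omega> = UNIV and A = "\<lambda>_. {f. \<forall>i\<in>{}. f i}"])
    show "Int_stable E"
    proof (rule Int_stableI)
      fix a b assume "a \<in> E" "b \<in> E"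
      then obtain J K where "finite J" "a = {f. \<forall>i\<in>J. f i}" "finite K" "b = {f. \<forall>i\<in>K. f i}"
        unfolding E_def by blast
      then have "a \<inter> b = {f. \<forall>i\<in>J \<union> K. f i}" "finite (J \<union> K)" by auto
      then show "a \<inter> b \<in> E" unfolding E_def by blast
    qed
    fix A assume "A \<in> E"
    then obtain J where J: "finite J" "A = {f. \<forall>i\<in>J. f i}" unfolding E_def by blast
    have "emeasure (distr M site_space \<xi>) A = ennreal \<P>(\<omega> in M. \<forall>i\<in>J. \<xi> \<omega> i)"
      unfolding J(2) emeasure_distr[OF \<xi>_meas E_sets[OF J(1)]] M.emeasure_eq_measure
      by (intro arg_cong[where f = "\<lambda>A. ennreal (measure M A)"]) auto
    also have "\<dots> = ennreal \<P>(\<omega> in N. \<forall>i\<in>J. \<eta> \<omega> i)" by (simp add: eq[OF J(1)])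
    also have "\<dots> = emeasure (distr N site_space \<eta>) A"
      unfolding J(2) emeasure_distr[OF \<eta>_meas E_sets[OF J(1)]] N.emeasure_eq_measure
      by (intro arg_cong[where f = "\<lambda>A. ennreal (measure N A)"]) auto
    finally show "emeasure (distr M site_space \<xi>) A = emeasure (distr N site_space \<eta>) A" .
  next
    show "range (\<lambda>_. {f. \<forall>i\<in>{}. f i}) \<subseteq> E" unfolding E_def by blast
    fix i :: nat
    show "emeasure (distr M site_space \<xi>) {f. \<forall>i\<in>{}. f i} \<noteq> \<infinity>"
      using emeasure_distr[OF \<xi>_meas E_sets[of "{}"]] by simp
  qed (simp_all add: gen)
  then have "measure (distr M site_space \<xi>) {f. Q f} = measure (distr N site_space \<eta>) {f. Q f}" by simp
  moreover have "{f. Q f} \<in> sets site_space" using Q by (simp add: pred_def space_site_space)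
  ultimately show ?thesis
    by (simp add: measure_distr[OF \<xi>_meas] measure_distr[OF \<eta>_meas] vimage_def Int_def conj_commute)
qed

section \<open>Site percolation compared with the two graph models\<close>

definition site_edges :: "('i \<Rightarrow> 'i \<Rightarrow> bool) \<Rightarrow> ('i \<Rightarrow> bool) \<Rightarrow> ('i \<times> 'i) set" where
  "site_edges adj f = {(z, w). f z \<and> f w \<and> adj z w}"

definition site_percolates :: "('i \<Rightarrow> 'i \<Rightarrow> bool) \<Rightarrow> ('i \<Rightarrow> bool) \<Rightarrow> bool" where
  "site_percolates adj f \<longleftrightarrow> (\<exists>z. f z \<and> infinite {w. (z, w) \<in> (site_edges adj f)\<^sup>*})"

lemma pred_site_percolates:
  "Measurable.pred site_space (site_percolates (adj :: 'i::countable \<Rightarrow> 'i \<Rightarrow> bool))"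
proof -
  have f: "Measurable.pred site_space (\<lambda>f. f i)" for i :: 'i
    by (rule measurable_component_singleton) simp
  have reach: "Measurable.pred site_space (\<lambda>f. (z, w) \<in> (site_edges adj f)\<^sup>*)" for z w
    by (rule pred_rtrancl[where I = UNIV]) (auto simp: site_edges_def intro!: pred_intros_logic f)
  \<comment> \<open>Infinitude is written as unboundedness of the codes, which uses countable
    quantifiers only.\<close>
  have inf: "infinite S \<longleftrightarrow> (\<forall>n. \<exists>w. n \<le> to_nat w \<and> w \<in> S)" for S :: "'i set"
  proof -
    have "infinite S \<longleftrightarrow> infinite (to_nat ` S)" by (simp add: finite_image_iff)
    then show ?thesis unfolding infinite_nat_iff_unbounded_le by blast
  qed
  show ?thesis
    unfolding site_percolates_def inf mem_Collect_eq
    by (intro pred_intros_logic(3) pred_intros_countable f reach) simp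
qed

text \<open>A walk in the graph projects to a walk on occupied cells. The image of an infinite
  component is infinite because each bounded cell holds only finitely many points of
  \<open>X\<close>.\<close>

lemma continuum_percolates_imp_sites:
  fixes X :: "'a::euclidean_space set" and C :: "'i \<Rightarrow> 'a set"
  assumes X: "X \<in> locally_finite_configs" and perc: "percolates X (continuum_edges \<rho> X)"
    and C: "\<And>x. x \<in> C (c x)" "\<And>z. bounded (C z)"
    and adj: "\<And>x y. dist x y \<le> 2 * \<rho> \<Longrightarrow> adj (c x) (c y)"
  shows "site_percolates adj (\<lambda>z. X \<inter> C z \<noteq> {})"
proof -
  let ?f = "\<lambda>z. X \<inter> C z \<noteq> {}"
  obtain x where x: "x \<in> X" and inf: "infinite {y\<in>X. (x, y) \<in> (continuum_edges \<rho> X)\<^sup>*}"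
    using perc unfolding percolates_iff by blast
  let ?S = "{y\<in>X. (x, y) \<in> (continuum_edges \<rho> X)\<^sup>*}"
  have f: "?f (c y)" if "y \<in> X" for y using C(1) that by blast
  have walk: "(c x, c y) \<in> (site_edges adj ?f)\<^sup>*" if "(x, y) \<in> (continuum_edges \<rho> X)\<^sup>*" for y
    using that
  proof induction
    case (step y z)
    then have "(c y, c z) \<in> site_edges adj ?f"
      using f adj by (auto simp: continuum_edges_def site_edges_def)
    with step.IH show ?case by (rule rtrancl.rtrancl_into_rtrancl)
  qed simp
  have "infinite (c ` ?S)"
  proof
    assume "finite (c ` ?S)"
    then have "finite (\<Union>z\<in>c ` ?S. X \<inter> C z)" by (rule finite_UN_I) (rule finite_Int_bounded[OF X C(2)])
    moreover have "?S \<subseteq> (\<Union>z\<in>c ` ?S. X \<inter> C z)" using C(1) by blast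
    ultimately show False using inf finite_subset by blast
  qed
  moreover have "c ` ?S \<subseteq> {w. (c x, w) \<in> (site_edges adj ?f)\<^sup>*}" using walk by blast
  ultimately have "infinite {w. (c x, w) \<in> (site_edges adj ?f)\<^sup>*}" using finite_subset by blast
  then show ?thesis unfolding site_percolates_def using f[OF x] by blast
qed

text \<open>One point is selected from each open site. Disjointness of the cells makes the selection
  injective, so an infinite cluster of sites selects infinitely many points, and \<open>link\<close>
  turns adjacency of different sites into edges.\<close>

lemma sites_imp_AB_percolates:
  fixes A :: "'i \<Rightarrow> 'a::metric_space set"
  assumes perc: "site_percolates adj f"
    and hit: "\<And>z. f z \<Longrightarrow> X \<inter> A z \<noteq> {}"
    and disj: "\<And>z w. z \<noteq> w \<Longrightarrow> A z \<inter> A w = {}"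
    and link: "\<And>z w x x'. f z \<Longrightarrow> f w \<Longrightarrow> adj z w \<Longrightarrow> x \<in> A z \<Longrightarrow> x' \<in> A w \<Longrightarrow>
      \<exists>y\<in>Y. dist x y \<le> 2 * r \<and> dist x' y \<le> 2 * r"
  shows "percolates X (AB_edges r X Y)"
proof -
  have "\<forall>z. \<exists>x. f z \<longrightarrow> x \<in> X \<inter> A z" using hit by blast
  from choice[OF this] obtain g where g: "\<And>z. f z \<Longrightarrow> g z \<in> X" "\<And>z. f z \<Longrightarrow> g z \<in> A z" by blast
  have g_inj: "z = w" if "f z" "f w" "g z = g w" for z w
    using disj[of z w] g(2)[OF that(1)] g(2)[OF that(2)] that(3) by auto
  obtain z where z: "f z" and inf: "infinite {w. (z, w) \<in> (site_edges adj f)\<^sup>*}"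
    using perc unfolding site_percolates_def by blast
  have walk: "f w \<and> (g z, g w) \<in> (AB_edges r X Y)\<^sup>*" if "(z, w) \<in> (site_edges adj f)\<^sup>*" for w
    using that
  proof induction
    case (step v w)
    then have vw: "f v" "f w" "adj v w" "(g z, g v) \<in> (AB_edges r X Y)\<^sup>*" by (auto simp: site_edges_def)
    show ?case
    \<comment> \<open>A site may be adjacent to itself, while the AB graph has no loops; such a step
      of the walk is dropped.\<close>
    proof (cases "v = w")
      case False
      then have "g v \<noteq> g w" using g_inj vw by blast
      then have "(g v, g w) \<in> AB_edges r X Y"
        using link[OF vw(1-3) g(2) g(2)] vw g(1) by (auto simp: AB_edges_def)
      with vw show ?thesis by (auto intro: rtrancl.rtrancl_into_rtrancl)
    qed (use vw in simp)
  qed (simp add: z)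
  have "inj_on g {w. (z, w) \<in> (site_edges adj f)\<^sup>*}" using walk g_inj by (auto intro!: inj_onI)
  with inf have "infinite (g ` {w. (z, w) \<in> (site_edges adj f)\<^sup>*})" by (simp add: finite_image_iff)
  moreover have "g ` {w. (z, w) \<in> (site_edges adj f)\<^sup>*} \<subseteq> {y\<in>X. (g z, y) \<in> (AB_edges r X Y)\<^sup>*}"
    using walk g(1) by auto
  ultimately have "infinite {y\<in>X. (g z, y) \<in> (AB_edges r X Y)\<^sup>*}" using finite_subset by blast
  then show ?thesis unfolding percolates_iff using g(1)[OF z] by blast
qed

section \<open>Discretisation of the plane\<close>

text \<open>Spacing \<open>d\<close> and side \<open>b\<close> are separate so that the squares can
  be reduced on a fixed lattice, which tunes the probability of being hit. Being half-open, the
  squares tile the plane exactly when \<open>b = d > 0\<close>.\<close>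

definition gbox :: "real \<Rightarrow> real \<Rightarrow> int^2 \<Rightarrow> (real^2) set" where
  "gbox d b z = {x. \<forall>i. d * of_int (z $ i) \<le> x $ i \<and> x $ i < d * of_int (z $ i) + b}"

lemma gbox_bounds:
  fixes d b :: real and z :: "int^2"
  defines "p \<equiv> (\<chi> i. d * of_int (z $ i))" and "q \<equiv> (\<chi> i. d * of_int (z $ i) + b)"
  shows "box p q \<subseteq> gbox d b z" "gbox d b z \<subseteq> cbox p q"
  by (auto simp: gbox_def p_def q_def mem_box_cart less_imp_le)

lemma gbox_borel: "gbox d b z \<in> sets borel"
proof -
  have "gbox d b z = (\<Inter>i. {x. d * of_int (z $ i) \<le> x $ i} \<inter> {x. x $ i < d * of_int (z $ i) + b})"
    by (auto simp: gbox_def)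
  also have "\<dots> \<in> sets borel" by measurable
  finally show ?thesis .
qed

lemma bounded_gbox: "bounded (gbox d b z)"
  by (rule bounded_subset[OF bounded_cbox gbox_bounds(2)])

lemma measure_gbox:
  assumes "b \<ge> 0"
  shows "measure lborel (gbox d b z) = b ^ 2"
proof -
  let ?p = "\<chi> i. d * of_int (z $ i)" and ?q = "\<chi> i. d * of_int (z $ i) + b"
  have "?p \<in> cbox ?p ?q" using assms by (simp add: mem_box_cart)
  then have "cbox ?p ?q \<noteq> {}" by (metis empty_iff)
  then have c: "measure lborel (cbox ?p ?q) = b ^ 2" by (simp add: content_cbox_cart)
  have "measure lborel (box ?p ?q) = measure lborel (cbox ?p ?q)"
    by (simp add: measure_lborel_box_eq measure_lborel_cbox_eq)
  moreover have "measure lborel (box ?p ?q) \<le> measure lborel (gbox d b z)"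
    using gbox_bounds(1) emeasure_bounded_finite[OF bounded_gbox]
    by (intro measure_mono_fmeasurable) (auto simp: fmeasurable_def gbox_borel)
  moreover have "measure lborel (gbox d b z) \<le> measure lborel (cbox ?p ?q)"
    using gbox_bounds(2) by (intro measure_mono_fmeasurable) (auto simp: gbox_borel)
  ultimately show ?thesis using c by simp
qed

lemma corner_in_gbox: "b > 0 \<Longrightarrow> (\<chi> i. d * of_int (z $ i)) \<in> gbox d b z"
  by (simp add: gbox_def)

lemma gbox_disjoint:
  assumes "b \<le> d" "d > 0" "z \<noteq> w"
  shows "gbox d b z \<inter> gbox d b w = {}"
proof (rule ccontr)
  assume "gbox d b z \<inter> gbox d b w \<noteq> {}"
  then obtain x where x: "x \<in> gbox d b z" "x \<in> gbox d b w" by blast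
  have "z $ i = w $ i" for i
  proof -
    have *: "d * of_int (z $ i) \<le> x $ i" "x $ i < d * of_int (z $ i) + d"
      "d * of_int (w $ i) \<le> x $ i" "x $ i < d * of_int (w $ i) + d"
      using x assms(1) by (auto simp: gbox_def intro: less_le_trans)
    have "\<lfloor>x $ i / d\<rfloor> = z $ i" "\<lfloor>x $ i / d\<rfloor> = w $ i"
      using * assms(2) by (auto simp: floor_eq_iff field_simps)
    then show ?thesis by simp
  qed
  with assms(3) show False by (simp add: vec_eq_iff)
qed

lemma in_gbox_floor: "d > 0 \<Longrightarrow> x \<in> gbox d d (\<chi> i. \<lfloor>x $ i / d\<rfloor>)"
  unfolding gbox_def
proof (intro CollectI allI)
  fix i assume d: "d > 0"
  have "d * of_int \<lfloor>x $ i / d\<rfloor> \<le> d * (x $ i / d)" "d * (x $ i / d) < d * (of_int \<lfloor>x $ i / d\<rfloor> + 1)"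
    using d by (intro mult_left_mono mult_strict_left_mono; simp)+
  with d show "d * of_int ((\<chi> i. \<lfloor>x $ i / d\<rfloor>) $ i) \<le> x $ i \<and> x $ i < d * of_int ((\<chi> i. \<lfloor>x $ i / d\<rfloor>) $ i) + d"
    by (simp add: distrib_left)
qed

section \<open>Lattice adjacency and private cells\<close>

definition rvec :: "int^2 \<Rightarrow> real^2" where
  "rvec v = (\<chi> i. of_int (v $ i))"

lemma norm_le_coords2:
  fixes x :: "real^2"
  assumes "\<And>i. \<bar>x $ i\<bar> \<le> c"
  shows "norm x \<le> 2 * c"
  using norm_le_l1_cart[of x] assms[of 1] assms[of 2] by (simp add: sum_2)

text \<open>The slack \<open>2 * e\<close> pays for replacing two points by the corners of their
  squares, which changes their difference by at most \<open>e\<close> in each of two coordinates.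
  The relation depends on \<open>w - z\<close> only, so the private cells of a site can be labelled
  by differences.\<close>

definition lattice_adj :: "real \<Rightarrow> real \<Rightarrow> int^2 \<Rightarrow> int^2 \<Rightarrow> bool" where
  "lattice_adj \<rho> e z w \<longleftrightarrow> e * norm (rvec (w - z)) \<le> 2 * \<rho> + 2 * e"

lemma lattice_adj_floor:
  assumes e: "e > 0" and xy: "dist x y \<le> 2 * \<rho>"
  shows "lattice_adj \<rho> e (\<chi> i. \<lfloor>x $ i / e\<rfloor>) (\<chi> i. \<lfloor>y $ i / e\<rfloor>)"
proof -
  let ?z = "\<chi> i. \<lfloor>x $ i / e\<rfloor>" and ?w = "\<chi> i. \<lfloor>y $ i / e\<rfloor>"
  let ?u = "rvec (?w - ?z)"
  have "\<bar>(e *\<^sub>R ?u - (y - x)) $ i\<bar> \<le> e" for i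
  proof -
    have "e * of_int \<lfloor>x $ i / e\<rfloor> \<le> x $ i" "x $ i < e * of_int \<lfloor>x $ i / e\<rfloor> + e"
      "e * of_int \<lfloor>y $ i / e\<rfloor> \<le> y $ i" "y $ i < e * of_int \<lfloor>y $ i / e\<rfloor> + e"
      using in_gbox_floor[OF e, of x] in_gbox_floor[OF e, of y] by (auto simp: gbox_def)
    then show ?thesis by (simp add: rvec_def algebra_simps abs_le_iff)
  qed
  then have "norm (e *\<^sub>R ?u - (y - x)) \<le> 2 * e" by (rule norm_le_coords2)
  moreover have "norm (e *\<^sub>R ?u) \<le> norm (e *\<^sub>R ?u - (y - x)) + norm (y - x)"
    using norm_triangle_ineq[of "e *\<^sub>R ?u - (y - x)" "y - x"] by simp
  ultimately show ?thesis
    using e xy unfolding lattice_adj_def by (simp add: dist_norm norm_minus_commute)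
qed

text \<open>The index of the private cell, in the lattice of spacing \<open>d / (2 * M)\<close>, of the pair formed by
  \<open>z\<close> and its neighbour \<open>z + v\<close>. The cell lies near the midpoint of that pair, and the extra summand
  \<open>v\<close> separates the pairs that have the same midpoint.\<close>

definition midcell :: "int \<Rightarrow> int^2 \<Rightarrow> int^2 \<Rightarrow> int^2" where
  "midcell M z v = (\<chi> i. 2 * M * z $ i + (M + 1) * v $ i)"

text \<open>Modulo \<open>M\<close> the index reduces to \<open>v\<close>, and two candidates for a
  coordinate of \<open>v\<close> differ by less than \<open>M\<close>, so they agree; then
  \<open>z\<close> is determined as well.\<close>

lemma midcell_inj:
  assumes "2 * R < M" "\<And>i. \<bar>v $ i\<bar> \<le> R" "\<And>i. \<bar>v' $ i\<bar> \<le> R" "midcell M z v = midcell M z' v'"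
  shows "z = z' \<and> v = v'"
proof -
  have "z $ i = z' $ i \<and> v $ i = v' $ i" for i
  proof -
    have "2 * M * z $ i + (M + 1) * v $ i = 2 * M * z' $ i + (M + 1) * v' $ i"
      using arg_cong[OF assms(4), of "\<lambda>u. u $ i"] by (simp add: midcell_def)
    then have eq: "M * (2 * (z $ i - z' $ i) + (v $ i - v' $ i)) = v' $ i - v $ i" by (simp add: algebra_simps)
    have "\<bar>v' $ i - v $ i\<bar> < M" using assms(1) assms(2)[of i] assms(3)[of i] by linarith
    moreover have "M dvd v' $ i - v $ i" unfolding eq[symmetric] by simp
    ultimately have "v' $ i - v $ i = 0" using zdvd_not_zless[of "\<bar>v' $ i - v $ i\<bar>" M] by (metis abs_ge_zero dvd_abs_iff order_le_less abs_eq_0)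
    moreover have "M > 0" using assms(1) assms(2)[of i] by linarith
    ultimately show ?thesis using eq by auto
  qed
  then show ?thesis by (auto simp: vec_eq_iff)
qed

text \<open>With \<open>u\<close> the lattice difference, \<open>y\<close> differs from the points
  of either square by half of \<open>d * u\<close>, up to sign and an error of \<open>2 * d\<close>
  in each coordinate, hence \<open>4 * d\<close> in norm. Half of \<open>d * u\<close> has norm at
  most \<open>s * (\<rho> + e)\<close>, and \<open>d = s * e\<close>, so the total is
  \<open>s * (\<rho> + 5 * e)\<close>.\<close>

lemma midcell_dist:
  assumes d: "d = s * e" "s > 0" "e > 0" "s * (\<rho> + 5 * e) \<le> \<rho>"
    and M: "M \<ge> 1" "R + 1 \<le> 2 * M" and b: "b \<le> d"
    and adj: "lattice_adj \<rho> e z w" and R: "\<And>i. \<bar>(w - z) $ i\<bar> \<le> R"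
    and x: "x \<in> gbox d b z" and x': "x' \<in> gbox d b w"
    and y: "y \<in> gbox (d / (2 * of_int M)) (d / (2 * of_int M)) (midcell M z (w - z))"
  shows "dist x y \<le> \<rho>" "dist x' y \<le> \<rho>"
proof -
  define h where "h = d / (2 * of_int M)"
  define u where "u = rvec (w - z)"
  have d0: "d > 0" using d by simp
  have h0: "h > 0" using d0 M by (simp add: h_def)
  have hM: "h * (2 * of_int M) = d" using M by (simp add: h_def)
  have "of_int (R + 1) \<le> (of_int (2 * M) :: real)" using M(2) by (simp only: of_int_le_iff)
  then have "h * (of_int R + 1) \<le> h * (2 * of_int M)"
    using h0 by (intro mult_left_mono) simp_all
  then have hR: "h * of_int R + h \<le> d" using hM by (simp add: algebra_simps)
  have hM1: "h * (of_int M + 1) = d / 2 + h" using hM by (simp add: algebra_simps)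
  \<comment> \<open>The part \<open>M * v\<close> of the index gives the midpoint shift
    \<open>d / 2 * u\<close>. The remaining \<open>v\<close> gives the separating shift
    \<open>h * u\<close>, which together with the side \<open>h\<close> of the cell is at most
    \<open>d\<close>.\<close>
  have coord: "\<bar>h * u $ i\<bar> + h \<le> d \<and> h * u $ i + d / 2 * u $ i + d * of_int (z $ i) \<le> y $ i \<and>
      y $ i < h * u $ i + d / 2 * u $ i + d * of_int (z $ i) + h" for i
  proof -
    have "\<bar>u $ i\<bar> \<le> of_int R"
    proof -
      have "(of_int \<bar>(w - z) $ i\<bar> :: real) \<le> of_int R" using R[of i] by (simp only: of_int_le_iff)
      then show ?thesis by (simp add: u_def rvec_def)
    qed
    then have "h * \<bar>u $ i\<bar> \<le> h * of_int R" using h0 by (intro mult_left_mono) auto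
    moreover have "\<bar>h * u $ i\<bar> = h * \<bar>u $ i\<bar>" using h0 by (simp add: abs_mult)
    ultimately have 1: "\<bar>h * u $ i\<bar> + h \<le> d" using hR by linarith
    have "h * of_int (midcell M z (w - z) $ i) = (h * (2 * of_int M)) * of_int (z $ i) + (h * (of_int M + 1)) * u $ i"
      by (simp add: midcell_def u_def rvec_def algebra_simps)
    also have "\<dots> = h * u $ i + d / 2 * u $ i + d * of_int (z $ i)"
      unfolding hM hM1 by (simp add: algebra_simps)
    finally have mid: "h * of_int (midcell M z (w - z) $ i) = h * u $ i + d / 2 * u $ i + d * of_int (z $ i)" .
    have "h * of_int (midcell M z (w - z) $ i) \<le> y $ i \<and> y $ i < h * of_int (midcell M z (w - z) $ i) + h"
      using y unfolding gbox_def h_def[symmetric] by blast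
    with 1 show ?thesis unfolding mid by blast
  qed
  have "d / 2 * norm u \<le> s / 2 * (e * norm u)" by (simp add: d)
  also have "\<dots> \<le> s / 2 * (2 * \<rho> + 2 * e)"
    using adj d(2) unfolding lattice_adj_def u_def by (intro mult_left_mono) auto
  finally have u: "norm ((d / 2) *\<^sub>R u) \<le> s * (\<rho> + e)" using d0 by (simp add: algebra_simps)
  have fin: "norm ((d / 2) *\<^sub>R u) + 2 * (2 * d) \<le> \<rho>" using u d by (simp add: algebra_simps)
  have "\<bar>(y - x - (d / 2) *\<^sub>R u) $ i\<bar> \<le> 2 * d" for i
  proof -
    have "d * of_int (z $ i) \<le> x $ i" "x $ i < d * of_int (z $ i) + d"
      using x b by (auto simp: gbox_def intro: less_le_trans)
    then show ?thesis using coord[of i] h0 d0 by (simp add: abs_le_iff) linarith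
  qed
  then have "norm (y - x - (d / 2) *\<^sub>R u) \<le> 2 * (2 * d)" by (rule norm_le_coords2)
  then show "dist x y \<le> \<rho>"
    using norm_triangle_ineq[of "y - x - (d / 2) *\<^sub>R u" "(d / 2) *\<^sub>R u"] fin
    by (simp add: dist_norm norm_minus_commute)
  \<comment> \<open>Seen from the square of \<open>w\<close>, the midpoint lies in the opposite
    direction, hence the plus sign.\<close>
  have "\<bar>(y - x' + (d / 2) *\<^sub>R u) $ i\<bar> \<le> 2 * d" for i
  proof -
    have "d * of_int (w $ i) \<le> x' $ i" "x' $ i < d * of_int (w $ i) + d"
      using x' b by (auto simp: gbox_def intro: less_le_trans)
    moreover have "d * of_int (w $ i) = d * of_int (z $ i) + d * u $ i"
      by (simp add: u_def rvec_def algebra_simps)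
    ultimately show ?thesis using coord[of i] h0 d0 by (simp add: abs_le_iff) linarith
  qed
  then have "norm (y - x' + (d / 2) *\<^sub>R u) \<le> 2 * (2 * d)" by (rule norm_le_coords2)
  then show "dist x' y \<le> \<rho>"
    using norm_triangle_ineq4[of "y - x' + (d / 2) *\<^sub>R u" "(d / 2) *\<^sub>R u"] fin
    by (simp add: dist_norm norm_minus_commute)
qed

lemma finite_int_vec_box: "finite {v :: int^2. \<forall>i. \<bar>v $ i\<bar> \<le> R}"
proof (rule finite_subset)
  show "{v :: int^2. \<forall>i. \<bar>v $ i\<bar> \<le> R} \<subseteq> (\<lambda>(a, b). vector [a, b]) ` ({- R..R} \<times> {- R..R})"
  proof
    fix v :: "int^2" assume v: "v \<in> {v. \<forall>i. \<bar>v $ i\<bar> \<le> R}"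
    have "v = (\<lambda>(a, b). vector [a, b]) (v $ 1, v $ 2)" by (simp add: vec_eq_iff forall_2)
    moreover have "(v $ 1, v $ 2) \<in> {- R..R} \<times> {- R..R}" using v by (auto simp: abs_le_iff minus_le_iff)
    ultimately show "v \<in> (\<lambda>(a, b). vector [a, b]) ` ({- R..R} \<times> {- R..R})" by (rule image_eqI)
  qed
qed simp

section \<open>Comparison of the two percolation probabilities\<close>

lemma pred_hits:
  fixes B :: "'a::euclidean_space set"
  assumes "\<xi> \<in> measurable M config_space" "B \<in> sets borel" "bounded B"
  shows "Measurable.pred M (\<lambda>\<omega>. \<xi> \<omega> \<inter> B \<noteq> {})"
  by (intro pred_intros_logic(2) measurable_compose[OF assms(1) Int_empty_measurable[OF assms(2,3)]])

lemma AB_theta_eq: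
  "AB_theta l m r = \<P>(\<omega> in (poisson_law l :: (real^2) set measure) \<Otimes>\<^sub>M (poisson_law m :: (real^2) set measure).
     percolates (fst \<omega>) (AB_edges r (fst \<omega>) (snd \<omega>)))"
  unfolding AB_theta_def by (rule arg_cong[where f = "measure _"]) auto

text \<open>By \<open>match\<close>, a site is good with the same probability with which a square of
  side \<open>e\<close> is occupied. Both kinds of events are independent over the sites, so the two
  site models have the same law; continuum percolation implies percolation of the first, and
  percolation of the second implies AB percolation. To join \<open>z\<close> and \<open>w\<close>,
  one cell owned by \<open>z\<close> suffices, so no two sites share a cell.\<close>

lemma continuum_theta_le_AB_theta:
  fixes r s e b l m \<nu> :: real and M R :: int
  assumes pos: "\<nu> > 0" "l > 0" "m > 0" "e > 0" "s > 0" "b > 0" "R \<ge> 0"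
    and scale: "s * (2 * r + 5 * e) \<le> 2 * r" "b \<le> s * e"
    and M: "2 * R < M" and R: "4 * r + 2 * e \<le> e * of_int R"
    and match: "(1 - exp (- (l * b ^ 2))) * (1 - exp (- (m * (s * e / (2 * of_int M)) ^ 2))) ^ card {v :: int^2. \<forall>i. \<bar>v $ i\<bar> \<le> R}
      = 1 - exp (- (\<nu> * e ^ 2))"
  shows "continuum_theta \<nu> (2 * r) \<le> AB_theta l m r"
proof -
  define V where "V = {v :: int^2. \<forall>i. \<bar>v $ i\<bar> \<le> R}"
  define d where "d = s * e"
  define h where "h = d / (2 * of_int M)"
  define A where "A = gbox d b"
  define S where "S = (\<lambda>(z, v). gbox h h (midcell M z v))"
  define C where "C = gbox e e"
  have M1: "M \<ge> 1" "R + 1 \<le> 2 * M" using M pos by auto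
  have d0: "d > 0" using pos by (simp add: d_def)
  have h0: "h > 0" using d0 M1 by (simp add: h_def)
  have finV: "finite V" unfolding V_def by (rule finite_int_vec_box)
  let ?L = "poisson_law l :: (real^2) set measure"
  let ?M = "poisson_law m :: (real^2) set measure"
  let ?N = "poisson_law \<nu> :: (real^2) set measure"
  interpret L: prob_space ?L using pos by (intro prob_space_poisson_law)
  interpret M: prob_space ?M using pos by (intro prob_space_poisson_law)
  interpret N: prob_space ?N using pos by (intro prob_space_poisson_law)
  interpret LM: pair_prob_space ?L ?M by unfold_locales
  have sets_L [measurable_cong]: "sets ?L = sets config_space" and sets_M [measurable_cong]: "sets ?M = sets config_space"
    and sets_N [measurable_cong]: "sets ?N = sets config_space"
    using pos by (simp_all add: sets_poisson_law)
  have sets_LM: "sets (?L \<Otimes>\<^sub>M ?M) = sets (config_space \<Otimes>\<^sub>M config_space)"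
    by (intro sets_pair_measure_cong sets_L sets_M)
  have A: "A z \<in> sets borel" "bounded (A z)" "A z \<noteq> {}" for z
    using corner_in_gbox[OF pos(6)] by (auto simp: A_def gbox_borel bounded_gbox)
  have C: "C z \<in> sets borel" "bounded (C z)" "C z \<noteq> {}" for z
    using corner_in_gbox[OF pos(4)] by (auto simp: C_def gbox_borel bounded_gbox)
  have S: "S zv \<in> sets borel" "bounded (S zv)" "S zv \<noteq> {}" for zv
    using corner_in_gbox[OF h0] by (auto simp: S_def gbox_borel bounded_gbox split: prod.splits)
  have A_disj: "A z \<inter> A w = {}" if "z \<noteq> w" for z w
    unfolding A_def using scale(2) d0 that by (intro gbox_disjoint) (simp_all add: d_def)
  have C_disj: "C z \<inter> C w = {}" if "z \<noteq> w" for z w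
    unfolding C_def using pos that by (intro gbox_disjoint) simp_all
  have S_disj: "disjoint_family_on S (J \<times> V)" for J
    unfolding disjoint_family_on_def
  proof (intro ballI impI)
    fix p q assume pq: "p \<in> J \<times> V" "q \<in> J \<times> V" "p \<noteq> q"
    obtain z v z' v' where zv: "p = (z, v)" "q = (z', v')" by (cases p, cases q)
    have "midcell M z v \<noteq> midcell M z' v'"
      using midcell_inj[OF M, of v v' z z'] pq zv by (auto simp: V_def)
    from gbox_disjoint[OF order_refl h0 this] show "S p \<inter> S q = {}" by (simp add: zv S_def)
  qed
  define occ where "occ X z \<longleftrightarrow> X \<inter> C z \<noteq> {}" for X z
  \<comment> \<open>The box \<open>V\<close> contains all differences of adjacent sites; surplus
    cells only raise the exponent in \<open>match\<close>.\<close>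
  define good where "good \<omega> z \<longleftrightarrow> fst \<omega> \<inter> A z \<noteq> {} \<and> (\<forall>v\<in>V. snd \<omega> \<inter> S (z, v) \<noteq> {})" for \<omega> :: "(real^2) set \<times> (real^2) set" and z
  let ?adj = "lattice_adj (2 * r) e"
  have occ_meas: "Measurable.pred ?N (\<lambda>X. occ X z)" for z
    unfolding occ_def by (intro pred_hits[OF measurable_ident_sets[OF sets_N]] C)
  have fst_meas: "fst \<in> measurable (?L \<Otimes>\<^sub>M ?M) config_space" and snd_meas: "snd \<in> measurable (?L \<Otimes>\<^sub>M ?M) config_space"
    by measurable
  have good_meas: "Measurable.pred (?L \<Otimes>\<^sub>M ?M) (\<lambda>\<omega>. good \<omega> z)" for z
    unfolding good_def by (intro pred_intros_logic(3) pred_intros_finite(3) finV pred_hits fst_meas snd_meas A S)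
  have "\<P>(X in ?N. site_percolates ?adj (occ X)) = \<P>(\<omega> in ?L \<Otimes>\<^sub>M ?M. site_percolates ?adj (good \<omega>))"
  proof (rule site_law_eqI[where Q = "site_percolates ?adj" and \<xi> = occ and \<eta> = good])
    fix J :: "(int^2) set" assume J: "finite J"
    have "\<P>(X in ?N. \<forall>z\<in>J. occ X z) = (\<Prod>z\<in>J. 1 - exp (- (\<nu> * measure lborel (C z))))"
      unfolding occ_def using C_disj by (intro poisson_law_hits pos J C) (auto simp: disjoint_family_on_def)
    also have "\<dots> = (1 - exp (- (\<nu> * e ^ 2))) ^ card J" using pos by (simp add: C_def measure_gbox)
    finally have 1: "\<P>(X in ?N. \<forall>z\<in>J. occ X z) = (1 - exp (- (\<nu> * e ^ 2))) ^ card J" .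
    have "\<P>(X in ?L. \<forall>z\<in>J. X \<inter> A z \<noteq> {}) = (\<Prod>z\<in>J. 1 - exp (- (l * measure lborel (A z))))"
      using A_disj by (intro poisson_law_hits pos J A) (auto simp: disjoint_family_on_def)
    also have "\<dots> = (1 - exp (- (l * b ^ 2))) ^ card J" using pos by (simp add: A_def measure_gbox)
    finally have 2: "\<P>(X in ?L. \<forall>z\<in>J. X \<inter> A z \<noteq> {}) = (1 - exp (- (l * b ^ 2))) ^ card J" .
    have "\<P>(Y in ?M. \<forall>p\<in>J \<times> V. Y \<inter> S p \<noteq> {}) = (\<Prod>p\<in>J \<times> V. 1 - exp (- (m * measure lborel (S p))))"
      using J finV by (intro poisson_law_hits pos S_disj S) auto
    also have "\<dots> = (\<Prod>p\<in>J \<times> V. 1 - exp (- (m * h ^ 2)))"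
      using h0 by (intro prod.cong refl) (auto simp: S_def measure_gbox)
    also have "\<dots> = ((1 - exp (- (m * h ^ 2))) ^ card V) ^ card J"
      by (simp add: card_cartesian_product mult.commute flip: power_mult)
    finally have 3: "\<P>(Y in ?M. \<forall>p\<in>J \<times> V. Y \<inter> S p \<noteq> {}) = ((1 - exp (- (m * h ^ 2))) ^ card V) ^ card J" .
    \<comment> \<open>The event is a rectangle, so by independence of the two processes its
      probability is a product.\<close>
    have "{\<omega> \<in> space (?L \<Otimes>\<^sub>M ?M). \<forall>z\<in>J. good \<omega> z} =
        {X \<in> space ?L. \<forall>z\<in>J. X \<inter> A z \<noteq> {}} \<times> {Y \<in> space ?M. \<forall>p\<in>J \<times> V. Y \<inter> S p \<noteq> {}}"
      by (auto simp: good_def space_pair_measure)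
    moreover have "{X \<in> space ?L. \<forall>z\<in>J. X \<inter> A z \<noteq> {}} \<in> sets ?L"
      using pred_intros_finite(3)[OF J pred_hits[OF measurable_ident_sets[OF sets_L] A(1,2)]]
      by (simp only: pred_def)
    moreover have "{Y \<in> space ?M. \<forall>p\<in>J \<times> V. Y \<inter> S p \<noteq> {}} \<in> sets ?M"
      using pred_intros_finite(3)[OF finite_cartesian_product[OF J finV] pred_hits[OF measurable_ident_sets[OF sets_M] S(1,2)]]
      by (simp only: pred_def)
    ultimately have "\<P>(\<omega> in ?L \<Otimes>\<^sub>M ?M. \<forall>z\<in>J. good \<omega> z) =
        \<P>(X in ?L. \<forall>z\<in>J. X \<inter> A z \<noteq> {}) * \<P>(Y in ?M. \<forall>p\<in>J \<times> V. Y \<inter> S p \<noteq> {})"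
      by (simp add: measure_def M.emeasure_pair_measure_Times enn2real_mult)
    also have "\<dots> = (1 - exp (- (\<nu> * e ^ 2))) ^ card J"
      unfolding 2 3 power_mult_distrib[symmetric] using match by (simp add: V_def h_def d_def)
    finally show "\<P>(X in ?N. \<forall>z\<in>J. occ X z) = \<P>(\<omega> in ?L \<Otimes>\<^sub>M ?M. \<forall>z\<in>J. good \<omega> z)" using 1 by simp
  next
    show "Measurable.pred site_space (site_percolates ?adj)" by (rule pred_site_percolates)
  qed (unfold_locales, (rule occ_meas good_meas)+)
  moreover have "continuum_theta \<nu> (2 * r) \<le> \<P>(X in ?N. site_percolates ?adj (occ X))"
    unfolding continuum_theta_def
  proof (rule N.finite_measure_mono)
    have "occ \<in> measurable ?N site_space" using occ_meas by (intro measurable_PiM_single') auto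
    from measurable_compose[OF this pred_site_percolates]
    show "{X \<in> space ?N. site_percolates ?adj (occ X)} \<in> sets ?N" by (simp add: pred_def)
    show "{X \<in> space ?N. percolates X (continuum_edges (2 * r) X)} \<subseteq> {X \<in> space ?N. site_percolates ?adj (occ X)}"
    proof (intro Collect_mono impI, elim conjE, intro conjI)
      fix X :: "(real^2) set" assume X: "X \<in> space ?N" "percolates X (continuum_edges (2 * r) X)"
      show "site_percolates ?adj (occ X)"
        unfolding occ_def[abs_def]
      proof (rule continuum_percolates_imp_sites[OF _ X(2)])
        show "X \<in> locally_finite_configs" using X(1) pos by simp
        show "x \<in> C (\<chi> i. \<lfloor>x $ i / e\<rfloor>)" for x unfolding C_def using pos by (intro in_gbox_floor)
        show "bounded (C z)" for z by (rule C)
        show "?adj (\<chi> i. \<lfloor>x $ i / e\<rfloor>) (\<chi> i. \<lfloor>y $ i / e\<rfloor>)" if "dist x y \<le> 2 * (2 * r)" for x y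
          using pos that by (intro lattice_adj_floor)
      qed
    qed
  qed
  moreover have "\<P>(\<omega> in ?L \<Otimes>\<^sub>M ?M. site_percolates ?adj (good \<omega>)) \<le> AB_theta l m r"
    unfolding AB_theta_eq
  proof (rule LM.finite_measure_mono)
    show "{\<omega> \<in> space (?L \<Otimes>\<^sub>M ?M). percolates (fst \<omega>) (AB_edges r (fst \<omega>) (snd \<omega>))} \<in> sets (?L \<Otimes>\<^sub>M ?M)"
      using measurable_percolates_AB[of r] sets_LM sets_eq_imp_space_eq[OF sets_LM]
      by (simp add: pred_def case_prod_beta)
    show "{\<omega> \<in> space (?L \<Otimes>\<^sub>M ?M). site_percolates ?adj (good \<omega>)} \<subseteq>
        {\<omega> \<in> space (?L \<Otimes>\<^sub>M ?M). percolates (fst \<omega>) (AB_edges r (fst \<omega>) (snd \<omega>))}"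
    proof (intro Collect_mono impI, elim conjE, intro conjI)
      fix \<omega> assume "site_percolates ?adj (good \<omega>)"
      then show "percolates (fst \<omega>) (AB_edges r (fst \<omega>) (snd \<omega>))"
      proof (rule sites_imp_AB_percolates[where A = A])
        show "fst \<omega> \<inter> A z \<noteq> {}" if "good \<omega> z" for z using that by (simp add: good_def)
        show "A z \<inter> A w = {}" if "z \<noteq> w" for z w using that by (rule A_disj)
        fix z w x x' assume zw: "good \<omega> z" "good \<omega> w" "?adj z w" and x: "x \<in> A z" "x' \<in> A w"
        have v: "\<bar>(w - z) $ i\<bar> \<le> R" for i
        proof -
          have "e * \<bar>of_int ((w - z) $ i)\<bar> \<le> e * norm (rvec (w - z))"
            using component_le_norm_cart[of "rvec (w - z)" i] pos by (intro mult_left_mono) (auto simp: rvec_def)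
          also have "\<dots> \<le> e * of_int R" using zw(3) R unfolding lattice_adj_def by linarith
          finally have "of_int \<bar>(w - z) $ i\<bar> \<le> (of_int R :: real)" using pos(4) by simp
          then show ?thesis by (simp only: of_int_le_iff)
        qed
        then have "w - z \<in> V" by (simp add: V_def)
        with zw(1) obtain y where y: "y \<in> snd \<omega>" "y \<in> S (z, w - z)" unfolding good_def by blast
        then have y': "y \<in> gbox (d / (2 * of_int M)) (d / (2 * of_int M)) (midcell M z (w - z))"
          by (simp add: S_def h_def)
        have "dist x y \<le> 2 * r" "dist x' y \<le> 2 * r"
          using midcell_dist[OF d_def pos(5,4) scale(1) M1 _ zw(3) v _ _ y', of b x x'] x scale(2)
          by (auto simp: A_def d_def)
        with y(1) show "\<exists>y\<in>snd \<omega>. dist x y \<le> 2 * r \<and> dist x' y \<le> 2 * r" by blast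
      qed
    qed
  qed
  ultimately show ?thesis by simp
qed

text \<open>The probability of hitting all private cells of a site tends to 1 as \<open>m\<close>
  grows, so eventually the loss is made up for by a square still within the spacing of the lattice.
  The bound is wanted for all large \<open>m\<close>, since it has to exclude them all from the set
  whose supremum is \<open>mu_c\<close>.\<close>

lemma AB_theta_eventually_ge:
  fixes r l \<nu> :: real
  assumes r: "r > 0" and \<nu>: "0 < \<nu>" "\<nu> < l"
  shows "eventually (\<lambda>m. continuum_theta \<nu> (2 * r) \<le> AB_theta l m r) at_top"
proof -
  \<comment> \<open>\<open>s ^ 2\<close> is the mean of 1 and \<open>\<nu> / l\<close>, so that
    \<open>s < 1\<close> while \<open>l * s ^ 2\<close> still exceeds \<open>\<nu>\<close>.\<close>
  define s where "s = sqrt ((1 + \<nu> / l) / 2)"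
  \<comment> \<open>This solves the scale condition with equality:
    \<open>s * (2 * r + 5 * e) = 2 * r\<close>. It is positive because \<open>s < 1\<close>.\<close>
  define e where "e = 2 * r * (1 - s) / (5 * s)"
  \<comment> \<open>The least integer with \<open>4 * r + 2 * e \<le> e * R\<close>; then
    \<open>M\<close> is the least integer above \<open>2 * R\<close>.\<close>
  define R where "R = \<lceil>4 * r / e + 2\<rceil>"
  define M where "M = 2 * R + 1"
  define c where "c = (s * e / (2 * of_int M)) ^ 2"
  define K where "K = card {v :: int^2. \<forall>i. \<bar>v $ i\<bar> \<le> R}"
  have l: "l > 0" using \<nu> by simp
  have s2: "s ^ 2 = (1 + \<nu> / l) / 2" unfolding s_def using \<nu> l by (intro real_sqrt_pow2) simp
  have s: "0 < s" "s < 1" unfolding s_def using \<nu> l by (auto simp: add_pos_pos)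
  have s2l: "l * s ^ 2 > \<nu>" unfolding s2 using \<nu> l by (simp add: field_simps)
  have e: "e > 0" unfolding e_def using r s by simp
  have scale: "s * (2 * r + 5 * e) = 2 * r" using s by (simp add: e_def field_simps)
  have R: "R \<ge> 0" "4 * r + 2 * e \<le> e * of_int R"
  proof -
    have "4 * r / e + 2 \<le> of_int R" by (simp add: R_def)
    then have "e * (4 * r / e + 2) \<le> e * of_int R" using e by (intro mult_left_mono) auto
    then show "4 * r + 2 * e \<le> e * of_int R" using e by (simp add: algebra_simps)
    then have "e * of_int R > 0" using r e by (smt (verit) mult_pos_pos)
    then show "R \<ge> 0" using e by (simp add: zero_less_mult_iff)
  qed
  have M: "2 * R < M" by (simp add: M_def)
  have c: "c > 0" unfolding c_def using s e R(1) by (simp add: M_def)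
  \<comment> \<open>\<open>p\<close> is the target probability, and \<open>p'\<close> is the chance
    of hitting a full square of side \<open>s * e\<close> at intensity \<open>l\<close>. The gap
    \<open>p < p'\<close> comes from \<open>l * s ^ 2 > \<nu>\<close> and leaves room for the factor
    lost to the private cells.\<close>
  define p where "p = 1 - exp (- (\<nu> * e ^ 2))"
  define p' where "p' = 1 - exp (- (l * (s * e) ^ 2))"
  have p: "0 < p" "p < p'"
  proof -
    show "0 < p" unfolding p_def using \<nu> e by simp
    have "\<nu> * e ^ 2 < l * s ^ 2 * e ^ 2" using s2l e by (intro mult_strict_right_mono) auto
    then show "p < p'" by (simp add: p_def p'_def power_mult_distrib mult.assoc)
  qed
  have "((\<lambda>m. (1 - exp (- (m * c))) ^ K) \<longlongrightarrow> (1 - 0) ^ K) at_top"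
  proof (intro tendsto_intros)
    have "filterlim (\<lambda>m. c * m) at_top at_top"
      by (rule filterlim_tendsto_pos_mult_at_top[OF tendsto_const c filterlim_ident])
    then have "filterlim (\<lambda>m. - (m * c)) at_bot at_top"
      by (simp add: filterlim_uminus_at_top mult.commute)
    from filterlim_compose[OF exp_at_bot this] show "((\<lambda>m. exp (- (m * c))) \<longlongrightarrow> 0) at_top" .
  qed
  moreover have "p / p' < (1 - 0) ^ K" using p by simp
  ultimately have "eventually (\<lambda>m. p / p' < (1 - exp (- (m * c))) ^ K) at_top"
    by (rule order_tendstoD)
  then show ?thesis
    using eventually_gt_at_top[of 0]
  proof eventually_elim
    case (elim m)
    define t where "t = (1 - exp (- (m * c))) ^ K"
    have t0: "t > 0" unfolding t_def using elim(2) c by (intro zero_less_power) simp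
    have pt: "0 < p / t" "p / t < p'" "p' < 1"
    proof -
      show "0 < p / t" using p t0 by simp
      have "p < t * p'" using elim(1) p by (simp add: t_def pos_divide_less_eq)
      then show "p / t < p'" using t0 by (simp add: pos_divide_less_eq mult.commute)
      show "p' < 1" by (simp add: p'_def)
    qed
    \<comment> \<open>The solution of \<open>(1 - exp (- (l * b ^ 2))) * t = p\<close>. It exists
      because \<open>p / t < 1\<close>, and \<open>p / t < p'\<close> keeps \<open>b\<close> below
      the spacing \<open>s * e\<close>.\<close>
    define b where "b = sqrt (- ln (1 - p / t) / l)"
    have "1 - p / t > 0" "1 - p / t < 1" using pt by auto
    then have ln0: "- ln (1 - p / t) > 0" by (simp add: ln_less_zero)
    then have q0: "- ln (1 - p / t) / l > 0" using l by (rule divide_pos_pos)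
    then have b0: "b > 0" unfolding b_def by (rule real_sqrt_gt_zero)
    have "b ^ 2 = - ln (1 - p / t) / l" unfolding b_def using q0 by (intro real_sqrt_pow2 less_imp_le)
    then have b2: "l * b ^ 2 = - ln (1 - p / t)" using l by simp
    have "exp (- (l * b ^ 2)) = 1 - p / t" unfolding b2 using pt by simp
    then have match: "(1 - exp (- (l * b ^ 2))) * t = p" using t0 by simp
    have "exp (- (l * (s * e) ^ 2)) < exp (- (l * b ^ 2))"
      using pt \<open>exp (- (l * b ^ 2)) = 1 - p / t\<close> by (simp add: p'_def)
    then have "b ^ 2 < (s * e) ^ 2" using l by simp
    then have "b \<le> s * e" using s e by (intro less_imp_le) (rule power_less_imp_less_base, auto)
    then show ?case
      using match scale R elim(2) b0 s e l \<nu>(1) M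
      by (intro continuum_theta_le_AB_theta[where s = s and e = e and b = b and M = M and R = R])
        (simp_all add: t_def c_def K_def p_def)
  qed
qed

text \<open>An intensity above the supremum \<open>lambda_c (2 * r)\<close> has positive percolation
  probability. This positive number bounds \<open>AB_theta l m r\<close> from below for all
  \<open>m \<ge> m0\<close>, so \<open>m0\<close> bounds the set that defines
  \<open>mu_c l r\<close>.\<close>

theorem theorem2p4:
  fixes r :: real
  assumes "r > 0"
  shows "\<forall>l::real. ennreal l > lambda_c (2 * r) \<longrightarrow> mu_c l r < \<infinity>"
proof (intro allI impI)
  fix l :: real assume l: "lambda_c (2 * r) < ennreal l"
  \<comment> \<open>Lying strictly above the critical value gives positivity; lying strictly below
    \<open>l\<close> leaves room for shrinking the lattice.\<close>
  obtain \<nu>' where \<nu>': "lambda_c (2 * r) < \<nu>'" "\<nu>' < ennreal l" using dense[OF l] by blast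
  define \<nu> where "\<nu> = enn2real \<nu>'"
  have "\<nu>' < \<top>" using \<nu>'(2) ennreal_less_top by (rule less_trans)
  then have \<nu>_eq: "\<nu>' = ennreal \<nu>" by (simp add: \<nu>_def)
  have "0 < ennreal \<nu>" using \<nu>'(1) unfolding \<nu>_eq by (rule le_less_trans[OF zero_le])
  then have \<nu>0: "\<nu> > 0" by simp
  have \<nu>l: "\<nu> < l" using \<nu>'(2) \<nu>0 unfolding \<nu>_eq by (simp add: ennreal_less_iff)
  have "continuum_theta \<nu> (2 * r) \<noteq> 0"
  proof
    assume "continuum_theta \<nu> (2 * r) = 0"
    then have "ennreal \<nu> \<le> lambda_c (2 * r)" unfolding lambda_c_def using \<nu>0 by (intro Sup_upper) blast
    with \<nu>'(1) show False by (simp add: \<nu>_eq)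
  qed
  then have "continuum_theta \<nu> (2 * r) > 0" by (simp add: continuum_theta_def zero_less_measure_iff)
  moreover obtain m0 where m0: "\<And>m. m \<ge> m0 \<Longrightarrow> continuum_theta \<nu> (2 * r) \<le> AB_theta l m r"
    using AB_theta_eventually_ge[OF assms \<nu>0 \<nu>l] unfolding eventually_at_top_linorder by blast
  ultimately have "m \<le> m0" if "AB_theta l m r = 0" for m
    using that by (smt (verit))
  then have "mu_c l r \<le> ennreal m0"
    unfolding mu_c_def by (intro Sup_least) (auto intro: ennreal_leI)
  then show "mu_c l r < \<infinity>" by (simp add: le_less_trans)
qed

end
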